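(* Let $W$ be the Weyl group of a connected semisimple algebraic group $G$ with respect to a maximal torus $T$ and Borel subgroup $B\supset T$, let $P\supseteq B$ be a parabolic subgroup, and let $w\in W^P$ be a Coxeter-type element. Then the interval $[e,w]_{W^P}=\{v\in W^P: v\le w\}$ (with the Bruhat order) is isomorphic to the poset, ordered by inclusion, of feasible sets of a supersolvable antimatroid. In particular, $[e,w]_{W^P}$ is a supersolvable join-distributive lattice, hence a supersolvable lattice.
   Context: $W^P$ is the set of minimal-length representatives of $W/W_P$, where $W_P$ is generated by simple reflections $s_\alpha$ with $U_\alpha\subset P$; $\le$ is the Bruhat order. An element of $W$ is of Coxeter type if it is a product of pairwise distinct simple reflections. Supersolvable antimatroid (Armstrong): a triple $(E,\mathcal F,\preccurlyeq)$ with $E$ a finite set, $\preccurlyeq$ a total order on $E$, $\mathcal F\subseteq 2^E$ with $\emptyset\in\mathcal F$, such that whenever $A,B\in\mathcal F$ with $B\not\subseteq A$ and $x=\min_{\preccurlyeq}(B\setminus A)$, one has $A\cup\{x\}\in\mathcal F$; elements of $\mathcal F$ are the feasible sets. A finite lattice $L$ is supersolvable if it has a maximal chain $\mathfrak m$ such that for every chain $\mathfrak c$ of $L$ the sublattice generated by $\mathfrak m\cup\mathfrak c$ is distributive. A finite lattice is join-distributive if it is semimodular and every interval $[x,y]$ in which $y$ is the join of the elements covering $x$ is a Boolean lattice (equivalently, it is the lattice of feasible sets of an antimatroid). *)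

theory Defs
  imports "HOL-Analysis.Analysis" "HOL-Algebra.Lattice" "HOL-Algebra.Bij"
    "HOL-Algebra.Generated_Groups"
begin

text \<open>
  Weyl groups of connected semisimple algebraic groups are given through their root systems.
  A pair $(G, T)$ corresponds to a reduced crystallographic root system \<open>\<Phi>\<close>, a Borel subgroup
  $B \supset T$ to a base \<open>\<Delta>\<close> of \<open>\<Phi>\<close> (the $U_\alpha \subset B$ being those with \<open>\<alpha>\<close> positive),
  and a parabolic subgroup $P \supseteq B$ to the set \<open>\<Psi>\<close> of all roots \<open>\<alpha>\<close> with
  $U_\alpha \subset P$, which is an arbitrary closed set of roots containing the positive ones.
\<close>

definition root_reflection :: "'a::euclidean_space \<Rightarrow> 'a \<Rightarrow> 'a" where
  "root_reflection \<alpha> = (\<lambda>x. x - (2 * (x \<bullet> \<alpha>) / (\<alpha> \<bullet> \<alpha>)) *\<^sub>R \<alpha>)"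

text \<open>
  The Euclidean space of the root system is \<open>span \<Phi>\<close> rather than the whole type, so that rank
  zero (\<open>\<Phi> = {}\<close>, trivial $G$) is included. Reflections fix the orthogonal complement of
  \<open>span \<Phi>\<close> pointwise, so the group they generate is the same on either space.
\<close>

definition root_system :: "'a::euclidean_space set \<Rightarrow> bool" where
  "root_system \<Phi> \<longleftrightarrow>
     finite \<Phi> \<and> 0 \<notin> \<Phi> \<and>
     (\<forall>\<alpha>\<in>\<Phi>. \<forall>\<beta>\<in>\<Phi>. root_reflection \<alpha> \<beta> \<in> \<Phi>) \<and>
     (\<forall>\<alpha>\<in>\<Phi>. \<forall>\<beta>\<in>\<Phi>. 2 * (\<beta> \<bullet> \<alpha>) / (\<alpha> \<bullet> \<alpha>) \<in> \<int>) \<and>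
     (\<forall>\<alpha>\<in>\<Phi>. \<forall>c::real. c *\<^sub>R \<alpha> \<in> \<Phi> \<longrightarrow> c = 1 \<or> c = -1)"

definition positive_roots :: "'a::euclidean_space set \<Rightarrow> 'a set \<Rightarrow> 'a set" where
  "positive_roots \<Phi> \<Delta> = {\<beta>\<in>\<Phi>. \<exists>c::'a \<Rightarrow> nat. \<beta> = (\<Sum>\<alpha>\<in>\<Delta>. real (c \<alpha>) *\<^sub>R \<alpha>)}"

definition root_base :: "'a::euclidean_space set \<Rightarrow> 'a set \<Rightarrow> bool" where
  "root_base \<Phi> \<Delta> \<longleftrightarrow>
     \<Delta> \<subseteq> \<Phi> \<and> independent \<Delta> \<and>
     (\<forall>\<beta>\<in>\<Phi>. \<beta> \<in> positive_roots \<Phi> \<Delta> \<or> - \<beta> \<in> positive_roots \<Phi> \<Delta>)"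

definition standard_parabolic :: "'a::euclidean_space set \<Rightarrow> 'a set \<Rightarrow> 'a set \<Rightarrow> bool" where
  "standard_parabolic \<Phi> \<Delta> \<Psi> \<longleftrightarrow>
     positive_roots \<Phi> \<Delta> \<subseteq> \<Psi> \<and> \<Psi> \<subseteq> \<Phi> \<and>
     (\<forall>\<alpha>\<in>\<Psi>. \<forall>\<beta>\<in>\<Psi>. \<alpha> + \<beta> \<in> \<Phi> \<longrightarrow> \<alpha> + \<beta> \<in> \<Psi>)"

definition weyl_group :: "'a::euclidean_space set \<Rightarrow> ('a \<Rightarrow> 'a) set" where
  "weyl_group \<Phi> = generate (BijGroup UNIV) (root_reflection ` \<Phi>)"

text \<open>
  With the positive root subgroups in $B$, the simple reflections belonging to $P$ are the
  $s_\alpha$ for which the \<^emph>\<open>negative\<close> root subgroup $U_{-\alpha}$ lies in $P$; the positive one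
  always does.
\<close>

definition parabolic_weyl :: "'a::euclidean_space set \<Rightarrow> 'a set \<Rightarrow> ('a \<Rightarrow> 'a) set" where
  "parabolic_weyl \<Delta> \<Psi> =
     generate (BijGroup UNIV) (root_reflection ` {\<alpha>\<in>\<Delta>. - \<alpha> \<in> \<Psi>})"

definition word_prod :: "('a \<Rightarrow> 'a) list \<Rightarrow> 'a \<Rightarrow> 'a" where
  "word_prod ss = foldr (\<circ>) ss id"

definition weyl_length :: "'a::euclidean_space set \<Rightarrow> ('a \<Rightarrow> 'a) \<Rightarrow> nat" where
  "weyl_length \<Delta> w =
     (LEAST n. \<exists>ss. set ss \<subseteq> root_reflection ` \<Delta> \<and> word_prod ss = w \<and> length ss = n)"

definition bruhat_step ::
    "'a::euclidean_space set \<Rightarrow> 'a set \<Rightarrow> ('a \<Rightarrow> 'a) \<Rightarrow> ('a \<Rightarrow> 'a) \<Rightarrow> bool" where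
  "bruhat_step \<Phi> \<Delta> u v \<longleftrightarrow>
     u \<in> weyl_group \<Phi> \<and> (\<exists>\<beta>\<in>\<Phi>. v = u \<circ> root_reflection \<beta>) \<and>
     weyl_length \<Delta> u < weyl_length \<Delta> v"

definition bruhat_le ::
    "'a::euclidean_space set \<Rightarrow> 'a set \<Rightarrow> ('a \<Rightarrow> 'a) \<Rightarrow> ('a \<Rightarrow> 'a) \<Rightarrow> bool" where
  "bruhat_le \<Phi> \<Delta> = (bruhat_step \<Phi> \<Delta>)\<^sup>*\<^sup>*"

definition min_coset_reps ::
    "'a::euclidean_space set \<Rightarrow> 'a set \<Rightarrow> 'a set \<Rightarrow> ('a \<Rightarrow> 'a) set" where
  "min_coset_reps \<Phi> \<Delta> \<Psi> =
     {w \<in> weyl_group \<Phi>. \<forall>u\<in>parabolic_weyl \<Delta> \<Psi>. weyl_length \<Delta> w \<le> weyl_length \<Delta> (w \<circ> u)}"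

definition coxeter_type :: "'a::euclidean_space set \<Rightarrow> ('a \<Rightarrow> 'a) \<Rightarrow> bool" where
  "coxeter_type \<Delta> w \<longleftrightarrow>
     (\<exists>ss. distinct ss \<and> set ss \<subseteq> root_reflection ` \<Delta> \<and> w = word_prod ss)"

definition bruhat_interval ::
    "'a::euclidean_space set \<Rightarrow> 'a set \<Rightarrow> 'a set \<Rightarrow> ('a \<Rightarrow> 'a) \<Rightarrow> ('a \<Rightarrow> 'a) gorder" where
  "bruhat_interval \<Phi> \<Delta> \<Psi> w =
     \<lparr>carrier = {v \<in> min_coset_reps \<Phi> \<Delta> \<Psi>. bruhat_le \<Phi> \<Delta> v w},
      eq = (=), le = bruhat_le \<Phi> \<Delta>\<rparr>"

definition supersolvable_antimatroid :: "'e set \<Rightarrow> 'e set set \<Rightarrow> 'e rel \<Rightarrow> bool" where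
  "supersolvable_antimatroid E F r \<longleftrightarrow>
     finite E \<and> linear_order_on E r \<and> F \<subseteq> Pow E \<and> {} \<in> F \<and>
     (\<forall>A\<in>F. \<forall>B\<in>F. \<forall>x\<in>B - A. (\<forall>y\<in>B - A. (x, y) \<in> r) \<longrightarrow> insert x A \<in> F)"

definition inclusion_order :: "'e set set \<Rightarrow> 'e set gorder" where
  "inclusion_order F = \<lparr>carrier = F, eq = (=), le = (\<subseteq>)\<rparr>"

definition order_iso :: "('a, 'c) gorder_scheme \<Rightarrow> ('b, 'd) gorder_scheme \<Rightarrow> ('a \<Rightarrow> 'b) \<Rightarrow> bool"
  where "order_iso L M f \<longleftrightarrow> order_emb L M f \<and> bij_betw f (carrier L) (carrier M)"

definition chain_in :: "('a, 'c) gorder_scheme \<Rightarrow> 'a set \<Rightarrow> bool" where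
  "chain_in L C \<longleftrightarrow> C \<subseteq> carrier L \<and> (\<forall>x\<in>C. \<forall>y\<in>C. x \<sqsubseteq>\<^bsub>L\<^esub> y \<or> y \<sqsubseteq>\<^bsub>L\<^esub> x)"

definition maximal_chain :: "('a, 'c) gorder_scheme \<Rightarrow> 'a set \<Rightarrow> bool" where
  "maximal_chain L M \<longleftrightarrow> chain_in L M \<and> (\<forall>C. chain_in L C \<and> M \<subseteq> C \<longrightarrow> C = M)"

inductive_set sublattice_generated :: "('a, 'c) gorder_scheme \<Rightarrow> 'a set \<Rightarrow> 'a set"
  for L and X where
    incl: "x \<in> X \<Longrightarrow> x \<in> sublattice_generated L X"
  | join: "x \<in> sublattice_generated L X \<Longrightarrow> y \<in> sublattice_generated L X \<Longrightarrow>
      x \<squnion>\<^bsub>L\<^esub> y \<in> sublattice_generated L X"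
  | meet: "x \<in> sublattice_generated L X \<Longrightarrow> y \<in> sublattice_generated L X \<Longrightarrow>
      x \<sqinter>\<^bsub>L\<^esub> y \<in> sublattice_generated L X"

definition distributive_on :: "('a, 'c) gorder_scheme \<Rightarrow> 'a set \<Rightarrow> bool" where
  "distributive_on L K \<longleftrightarrow>
     (\<forall>x\<in>K. \<forall>y\<in>K. \<forall>z\<in>K. x \<sqinter>\<^bsub>L\<^esub> (y \<squnion>\<^bsub>L\<^esub> z) = (x \<sqinter>\<^bsub>L\<^esub> y) \<squnion>\<^bsub>L\<^esub> (x \<sqinter>\<^bsub>L\<^esub> z))"

definition finite_lattice :: "('a, 'c) gorder_scheme \<Rightarrow> bool" where
  "finite_lattice L \<longleftrightarrow> lattice L \<and> finite (carrier L) \<and> carrier L \<noteq> {}"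

definition supersolvable_lattice :: "('a, 'c) gorder_scheme \<Rightarrow> bool" where
  "supersolvable_lattice L \<longleftrightarrow>
     finite_lattice L \<and>
     (\<exists>M. maximal_chain L M \<and>
        (\<forall>C. chain_in L C \<longrightarrow> distributive_on L (sublattice_generated L (M \<union> C))))"

definition covered_by :: "('a, 'c) gorder_scheme \<Rightarrow> 'a \<Rightarrow> 'a \<Rightarrow> bool" where
  "covered_by L x y \<longleftrightarrow>
     x \<in> carrier L \<and> y \<in> carrier L \<and> x \<sqsubset>\<^bsub>L\<^esub> y \<and>
     \<not> (\<exists>z\<in>carrier L. x \<sqsubset>\<^bsub>L\<^esub> z \<and> z \<sqsubset>\<^bsub>L\<^esub> y)"

definition semimodular :: "('a, 'c) gorder_scheme \<Rightarrow> bool" where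
  "semimodular L \<longleftrightarrow>
     (\<forall>x\<in>carrier L. \<forall>y\<in>carrier L.
        covered_by L (x \<sqinter>\<^bsub>L\<^esub> y) x \<longrightarrow> covered_by L y (x \<squnion>\<^bsub>L\<^esub> y))"

definition boolean_lattice :: "('a, 'c) gorder_scheme \<Rightarrow> bool" where
  "boolean_lattice L \<longleftrightarrow>
     bounded_lattice L \<and> distributive_on L (carrier L) \<and>
     (\<forall>x\<in>carrier L. \<exists>y\<in>carrier L. x \<sqinter>\<^bsub>L\<^esub> y = \<bottom>\<^bsub>L\<^esub> \<and> x \<squnion>\<^bsub>L\<^esub> y = \<top>\<^bsub>L\<^esub>)"

definition interval_order :: "('a, 'c) gorder_scheme \<Rightarrow> 'a \<Rightarrow> 'a \<Rightarrow> ('a, 'c) gorder_scheme" where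
  "interval_order L x y = L\<lparr>carrier := \<lbrace>x..y\<rbrace>\<^bsub>L\<^esub>\<rparr>"

text \<open>
  The join and the covering elements are taken within the interval \<open>[x, y]\<close>. This includes the
  case where \<open>y\<close> is the join of all elements of \<open>L\<close> that cover \<open>x\<close>, as these then lie in the
  interval.
\<close>

definition join_distributive_lattice :: "('a, 'c) gorder_scheme \<Rightarrow> bool" where
  "join_distributive_lattice L \<longleftrightarrow>
     finite_lattice L \<and> semimodular L \<and>
     (\<forall>x\<in>carrier L. \<forall>y\<in>carrier L. x \<sqsubseteq>\<^bsub>L\<^esub> y \<longrightarrow>
        is_lub (interval_order L x y) y {z \<in> \<lbrace>x..y\<rbrace>\<^bsub>L\<^esub>. covered_by L x z} \<longrightarrow>
        boolean_lattice (interval_order L x y))"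

end

theory Submission
  imports Defs
begin

text \<open>
  Write $w = s_1 \cdots s_n$ with distinct simple reflections. By the strong exchange property, the
  elements below \<open>w\<close> are the products $w_A$ of the subwords at the positions in
  $A \subseteq \{1, \ldots, n\}$, and the Bruhat order among them is inclusion of position sets.
  Let \<open>I\<close> be the set of simple roots of the parabolic. Then $w_A$ is a minimal coset
  representative iff every position in \<open>A\<close> carrying a letter of \<open>I\<close> is followed in \<open>A\<close> by a letter
  that does not commute with it: if some letter of \<open>I\<close> violates this, it can be moved to the end and
  cancelled; otherwise $w_A u$, for \<open>u\<close> in the parabolic subgroup, moves an antidominant vector
  fixed by \<open>u\<close> by a combination of simple roots that is strictly positive on all letters of $w_A$,
  so that no word for $w_A u$ can avoid any of these letters. Such sets \<open>A\<close> form a supersolvable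
  antimatroid for the reversed order of positions.

  In the lattice of feasible sets of a supersolvable antimatroid the join is union. The initial
  segments of the ground set form a maximal chain, and intersecting a feasible set with an initial
  segment gives a feasible set; hence, together with any chain, they generate a ring of sets.
\<close>

subsection \<open>Words in reflections\<close>

lemma word_prod_simps [simp]:
  "word_prod [] = id" "word_prod (s # ss) = s \<circ> word_prod ss"
  by (simp_all add: word_prod_def)

lemma word_prod_append [simp]: "word_prod (ss @ ts) = word_prod ss \<circ> word_prod ts"
  by (induction ss) (simp_all add: o_assoc)

abbreviation reflection_word :: "'a::euclidean_space list \<Rightarrow> 'a \<Rightarrow> 'a" where
  "reflection_word as \<equiv> word_prod (map root_reflection as)"

lemma linear_root_reflection: "linear (root_reflection a)"
  unfolding root_reflection_def
  by (rule linearI) (simp_all add: algebra_simps inner_add_left add_divide_distrib scaleR_add_left)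

lemma root_reflection_root_reflection [simp]: "root_reflection a (root_reflection a x) = x"
  by (cases "a = 0") (simp_all add: root_reflection_def algebra_simps inner_diff_left)

lemma root_reflection_comp_self [simp]: "root_reflection a \<circ> root_reflection a = id"
  by (simp add: fun_eq_iff)

lemma inner_root_reflection: "root_reflection a x \<bullet> y = x \<bullet> root_reflection a y"
  by (simp add: root_reflection_def inner_diff_left inner_diff_right inner_commute)

lemma root_reflection_uminus [simp]: "root_reflection (- a) = root_reflection a"
  by (simp add: root_reflection_def)

lemma root_reflection_self: "a \<noteq> 0 \<Longrightarrow> root_reflection a a = - a"
  by (simp add: root_reflection_def scaleR_2)

text \<open>A reflection is a self-adjoint involution and therefore preserves inner products. Moving
  it across the inner product turns the conjugate of a reflection into the reflection in the image
  vector.\<close>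

lemma root_reflection_image:
  "root_reflection (root_reflection a b) = root_reflection a \<circ> root_reflection b \<circ> root_reflection a"
proof
  fix x
  have 1: "root_reflection a b \<bullet> root_reflection a b = b \<bullet> b"
    by (simp add: inner_root_reflection)
  have 2: "x \<bullet> root_reflection a b = root_reflection a x \<bullet> b"
    by (simp add: inner_root_reflection)
  have "(root_reflection a \<circ> root_reflection b \<circ> root_reflection a) x =
    root_reflection a (root_reflection a x - (2 * (root_reflection a x \<bullet> b) / (b \<bullet> b)) *\<^sub>R b)"
    by (simp add: root_reflection_def[of b])
  also have "\<dots> = x - (2 * (root_reflection a x \<bullet> b) / (b \<bullet> b)) *\<^sub>R root_reflection a b"
    using linear_root_reflection[of a] by (simp add: linear_diff linear_scale)
  also have "\<dots> = root_reflection (root_reflection a b) x"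
    by (simp only: root_reflection_def[of "root_reflection a b"] 1 2)
  finally show "root_reflection (root_reflection a b) x =
    (root_reflection a \<circ> root_reflection b \<circ> root_reflection a) x" by simp
qed

lemma linear_reflection_word: "linear (reflection_word as)"
proof (induction as)
  case Nil
  then show ?case by (simp add: id_def linear_ident)
next
  case (Cons a as)
  then show ?case unfolding list.map word_prod_simps by (intro linear_compose linear_root_reflection)
qed

lemma reflection_word_rev:
  "reflection_word (rev as) \<circ> reflection_word as = id"
  "reflection_word as \<circ> reflection_word (rev as) = id"
  by (induction as) (simp_all add: fun_eq_iff)

lemma reflection_word_rev_apply [simp]:
  "reflection_word (rev as) (reflection_word as x) = x"
  "reflection_word as (reflection_word (rev as) x) = x"
  using reflection_word_rev[of as] by (simp_all add: fun_eq_iff)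

lemma root_reflection_word_image:
  "root_reflection (reflection_word as b) = reflection_word as \<circ> root_reflection b \<circ> reflection_word (rev as)"
  by (induction as) (simp_all add: root_reflection_image o_assoc)

lemma root_reflection_comm:
  assumes "a \<bullet> b = 0"
  shows "root_reflection a \<circ> root_reflection b = root_reflection b \<circ> root_reflection a"
  using assms
  by (simp add: fun_eq_iff root_reflection_def inner_diff_left inner_commute algebra_simps)

lemma reflection_word_comm:
  assumes "\<forall>c\<in>set as. b \<bullet> c = 0"
  shows "reflection_word as \<circ> root_reflection b = root_reflection b \<circ> reflection_word as"
  using assms
proof (induction as)
  case (Cons a as)
  then show ?case
    using root_reflection_comm[of b a] by (simp add: fun_eq_iff)
qed simp

lemma reflection_word_fixes:
  assumes "\<forall>a\<in>set as. x \<bullet> a = 0"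
  shows "reflection_word as x = x"
  using assms by (induction as) (simp_all add: root_reflection_def)

text \<open>Each reflection changes a vector by a multiple of its own letter. Hence a letter that is
  absent from a word leaves no trace in the displacement, which \<open>letters_subset\<close>
  exploits.\<close>

lemma reflection_word_diff_span: "reflection_word as x - x \<in> span (set as)"
proof (induction as)
  case (Cons a as)
  have "reflection_word (a # as) x - x = (reflection_word as x - x) -
      (2 * (reflection_word as x \<bullet> a) / (a \<bullet> a)) *\<^sub>R a"
    by (simp add: root_reflection_def)
  moreover have "reflection_word as x - x \<in> span (set (a # as))"
    using Cons span_mono[of "set as" "set (a # as)"] by auto
  ultimately show ?case by (metis list.set_intros(1) span_base span_diff span_scale)
qed (simp add: span_zero)

lemma bij_root_reflection: "bij (root_reflection a)"
  by (rule o_bij) (rule root_reflection_comp_self)+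

lemma generate_reflections:
  "generate (BijGroup UNIV) (root_reflection ` J) = {reflection_word as |as. set as \<subseteq> J}"
proof -
  have Bij: "root_reflection a \<in> Bij UNIV" for a :: 'a
    by (simp add: Bij_def bij_root_reflection)
  have Bij_word: "reflection_word as \<in> Bij UNIV" for as :: "'a list"
    by (simp add: Bij_def o_bij[OF reflection_word_rev])
  have one: "\<one>\<^bsub>BijGroup UNIV\<^esub> = (id :: 'a \<Rightarrow> 'a)"
    by (simp add: BijGroup_def fun_eq_iff)
  \<comment> \<open>Multiplication in \<open>BijGroup\<close> is composition only on
    \<open>Bij UNIV\<close>, which is why \<open>Bij\<close> and \<open>Bij_word\<close> are
    needed.\<close>
  have mult: "f \<otimes>\<^bsub>BijGroup UNIV\<^esub> g = f \<circ> g" if "f \<in> Bij UNIV" "g \<in> Bij UNIV" for f g :: "'a \<Rightarrow> 'a"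
    using that by (simp add: BijGroup_def compose_def fun_eq_iff)
  have inv: "inv\<^bsub>BijGroup UNIV\<^esub> (root_reflection a) = root_reflection a" for a :: 'a
    using group.inv_equality[OF group_BijGroup, of "UNIV" "root_reflection a" "root_reflection a"]
    by (simp add: Bij mult one) (simp add: BijGroup_def Bij)
  show ?thesis
  proof (intro equalityI subsetI)
    fix g assume "g \<in> generate (BijGroup UNIV) (root_reflection ` J)"
    then show "g \<in> {reflection_word as |as. set as \<subseteq> J}"
    proof induction
      case one
      show ?case unfolding \<open>\<one>\<^bsub>BijGroup UNIV\<^esub> = id\<close> by (auto intro!: exI[of _ "[]"])
    next
      case (incl h)
      then obtain a where "a \<in> J" "h = root_reflection a" by blast
      then show ?case by (auto intro!: exI[of _ "[a]"])
    next
      case (inv h)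
      then obtain a where "a \<in> J" "h = root_reflection a" by blast
      then show ?case
        unfolding \<open>h = _\<close> \<open>\<And>a. inv\<^bsub>BijGroup UNIV\<^esub> (root_reflection a) = root_reflection a\<close>
        by (auto intro!: exI[of _ "[a]"])
    next
      case (eng g h)
      then obtain as bs where "set as \<subseteq> J" "set bs \<subseteq> J" "g = reflection_word as" "h = reflection_word bs"
        by blast
      then show ?case by (auto simp: mult Bij_word intro!: exI[of _ "as @ bs"])
    qed
  next
    fix g assume "g \<in> {reflection_word as |as. set as \<subseteq> J}"
    then obtain as where "set as \<subseteq> J" "g = reflection_word as" by blast
    then show "g \<in> generate (BijGroup UNIV) (root_reflection ` J)"
    proof (induction as arbitrary: g)
      case Nil
      have "g = \<one>\<^bsub>BijGroup UNIV\<^esub>" unfolding one Nil(2) by (simp only: list.map word_prod_simps)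
      then show ?case by (simp only: generate.one)
    next
      case (Cons a as)
      then have "root_reflection a \<otimes>\<^bsub>BijGroup UNIV\<^esub> reflection_word as
          \<in> generate (BijGroup UNIV) (root_reflection ` J)"
        by (intro generate.eng generate.incl Cons.IH) auto
      then show ?case
        unfolding Cons.prems(2) mult[OF Bij Bij_word] by (simp only: list.map word_prod_simps)
    qed
  qed
qed

subsection \<open>Root systems with a base\<close>

lemma sum_in_Nats: "(\<And>x. x \<in> S \<Longrightarrow> g x \<in> \<nat>) \<Longrightarrow> sum g S \<in> (\<nat> :: 'b::semiring_1 set)"
  by (induction S rule: infinite_finite_induct) auto

locale based_root_system =
  fixes \<Phi> \<Delta> :: "'a::euclidean_space set"
  assumes root_system: "root_system \<Phi>" and root_base: "root_base \<Phi> \<Delta>"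
begin

abbreviation "pos \<equiv> positive_roots \<Phi> \<Delta>"

lemma finite_base: "finite \<Delta>"
  using root_system root_base by (auto simp: root_system_def root_base_def intro: finite_subset)

lemma base_subset: "\<Delta> \<subseteq> \<Phi>"
  using root_base by (simp add: root_base_def)

lemma root_nonzero: "a \<in> \<Phi> \<Longrightarrow> a \<noteq> 0"
  using root_system by (auto simp: root_system_def)

lemma reflection_root: "a \<in> \<Phi> \<Longrightarrow> b \<in> \<Phi> \<Longrightarrow> root_reflection a b \<in> \<Phi>"
  using root_system by (auto simp: root_system_def)

lemma reflection_word_root:
  assumes "set as \<subseteq> \<Phi>" "b \<in> \<Phi>" shows "reflection_word as b \<in> \<Phi>"
  using assms by (induction as) (simp_all add: reflection_root)

text \<open>Independence of the base extends any function on it to a linear functional, and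
  \<open>adjoint f 1\<close> is the vector that represents this functional.\<close>

lemma ex_prescribed_inner: "\<exists>x. \<forall>a\<in>\<Delta>. x \<bullet> a = g a"
proof -
  have "independent \<Delta>" using root_base by (simp add: root_base_def)
  from linear_independent_extend[OF this, of g] obtain f :: "'a \<Rightarrow> real"
    where f: "linear f" "\<forall>a\<in>\<Delta>. f a = g a" by blast
  have "adjoint f 1 \<bullet> a = f a" for a
    using adjoint_works[OF f(1), of a 1] by (simp add: inner_commute)
  with f(2) show ?thesis by metis
qed

text \<open>For a simple root \<open>a\<close> this is a fundamental coweight, up to a vector
  orthogonal to the span of the base. Pairing with it reads off the coefficient of \<open>a\<close>,
  so that signs of roots become inequalities.\<close>

definition dual_vector :: "'a \<Rightarrow> 'a" where
  "dual_vector a = (SOME x. \<forall>b\<in>\<Delta>. x \<bullet> b = (if b = a then 1 else 0))"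

lemma dual_vector: "b \<in> \<Delta> \<Longrightarrow> dual_vector a \<bullet> b = (if b = a then 1 else 0)"
  using someI_ex[OF ex_prescribed_inner[of "\<lambda>b. if b = a then 1 else 0"]]
  unfolding dual_vector_def by blast

lemma dual_vector_sum:
  "a \<in> \<Delta> \<Longrightarrow> S \<subseteq> \<Delta> \<Longrightarrow> dual_vector a \<bullet> (\<Sum>b\<in>S. c b *\<^sub>R b) = (if a \<in> S then c a else 0)"
proof -
  assume "a \<in> \<Delta>" and S: "S \<subseteq> \<Delta>"
  have "finite S" using S finite_base finite_subset by blast
  have "dual_vector a \<bullet> (\<Sum>b\<in>S. c b *\<^sub>R b) = (\<Sum>b\<in>S. if b = a then c b else 0)"
    unfolding inner_sum_right using S
    by (intro sum.cong) (auto simp: dual_vector)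
  with \<open>finite S\<close> show ?thesis by (simp add: sum.delta)
qed

section \<open>Coefficients and signs of roots\<close>

lemma positive_expansion:
  assumes "b \<in> pos"
  shows "b \<in> \<Phi>" "b = (\<Sum>a\<in>\<Delta>. (dual_vector a \<bullet> b) *\<^sub>R a)"
    "a \<in> \<Delta> \<Longrightarrow> dual_vector a \<bullet> b \<in> \<nat>"
proof -
  from assms obtain c :: "'a \<Rightarrow> nat" where c: "b \<in> \<Phi>" "b = (\<Sum>a\<in>\<Delta>. real (c a) *\<^sub>R a)"
    by (auto simp: positive_roots_def)
  have d: "dual_vector a \<bullet> b = real (c a)" if "a \<in> \<Delta>" for a
    using dual_vector_sum[OF that, of \<Delta> "\<lambda>a. real (c a)"] that c(2) by simp
  show "b \<in> \<Phi>" by fact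
  show "b = (\<Sum>a\<in>\<Delta>. (dual_vector a \<bullet> b) *\<^sub>R a)"
    by (subst c(2)) (simp add: d)
  show "dual_vector a \<bullet> b \<in> \<nat>" if "a \<in> \<Delta>"
    using d[OF that] by simp
qed

lemma positive_coeff_ge_0: "b \<in> pos \<Longrightarrow> a \<in> \<Delta> \<Longrightarrow> dual_vector a \<bullet> b \<ge> 0"
  using positive_expansion(3)[of b a] by (auto simp: Nats_def)

lemma positive_or_negative: "b \<in> \<Phi> \<Longrightarrow> b \<in> pos \<or> - b \<in> pos"
  using root_base by (auto simp: root_base_def)

lemma positive_if_coeff_positive:
  assumes "b \<in> \<Phi>" "a \<in> \<Delta>" "dual_vector a \<bullet> b > 0" shows "b \<in> pos"
  using positive_or_negative[OF assms(1)] positive_coeff_ge_0[of "- b" a] assms by auto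

lemma not_both_positive:
  assumes "b \<in> pos" shows "- b \<notin> pos"
proof
  assume "- b \<in> pos"
  then have "dual_vector a \<bullet> b = 0" if "a \<in> \<Delta>" for a
    using positive_coeff_ge_0[OF assms that] positive_coeff_ge_0[of "- b", OF _ that] by auto
  then have "b = 0" using positive_expansion(2)[OF assms] by simp
  then show False using positive_expansion(1)[OF assms] root_nonzero by blast
qed

lemma base_positive: "a \<in> \<Delta> \<Longrightarrow> a \<in> pos"
  using positive_if_coeff_positive[of a a] base_subset dual_vector[of a a] by auto

text \<open>The reflection in \<open>a\<close> alters only the coefficient of \<open>a\<close>.
  Since the root system is reduced, a positive root other than \<open>a\<close> has a positive
  coefficient at some further simple root; this one survives and fixes the sign of the
  image.\<close>

lemma simple_reflection_positive:
  assumes a: "a \<in> \<Delta>" and b: "b \<in> pos" and "b \<noteq> a"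
  shows "root_reflection a b \<in> pos"
proof -
  have "\<exists>c\<in>\<Delta>. c \<noteq> a \<and> dual_vector c \<bullet> b > 0"
  proof (rule ccontr)
    assume *: "\<not> ?thesis"
    have "dual_vector c \<bullet> b = 0" if "c \<in> \<Delta> - {a}" for c
      using * that positive_coeff_ge_0[OF b, of c] by force
    then have "(\<Sum>c\<in>\<Delta>. (dual_vector c \<bullet> b) *\<^sub>R c) = (dual_vector a \<bullet> b) *\<^sub>R a"
      using a by (simp add: sum.remove[OF finite_base a])
    then have eq: "b = (dual_vector a \<bullet> b) *\<^sub>R a"
      using positive_expansion(2)[OF b] by metis
    have "a \<in> \<Phi>" using a base_subset by blast
    moreover have "(dual_vector a \<bullet> b) *\<^sub>R a \<in> \<Phi>" using eq positive_expansion(1)[OF b] by metis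
    ultimately have "dual_vector a \<bullet> b = 1 \<or> dual_vector a \<bullet> b = -1"
      using root_system by (auto simp: root_system_def)
    then have "dual_vector a \<bullet> b = 1" using positive_coeff_ge_0[OF b a] by linarith
    with eq \<open>b \<noteq> a\<close> show False by simp
  qed
  then obtain c where c: "c \<in> \<Delta>" "c \<noteq> a" "dual_vector c \<bullet> b > 0" by blast
  have "dual_vector c \<bullet> root_reflection a b = dual_vector c \<bullet> b"
    using c a by (simp add: root_reflection_def inner_diff_right dual_vector)
  moreover have "root_reflection a b \<in> \<Phi>"
    using a b base_subset positive_expansion(1) reflection_root by blast
  ultimately show ?thesis using c positive_if_coeff_positive by metis
qed

text \<open>If the inner product were positive, reflecting \<open>b\<close> in \<open>a\<close>
  would give a root with a negative coefficient at \<open>a\<close>, although this root has to be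
  positive.\<close>

lemma base_obtuse:
  assumes a: "a \<in> \<Delta>" and b: "b \<in> \<Delta>" and "a \<noteq> b" shows "a \<bullet> b \<le> 0"
proof (rule ccontr)
  assume "\<not> ?thesis"
  then have ab: "b \<bullet> a > 0" by (simp add: inner_commute)
  have "a \<noteq> 0" using a base_subset root_nonzero by blast
  have "dual_vector a \<bullet> root_reflection a b = - (2 * (b \<bullet> a) / (a \<bullet> a))"
    using a b \<open>a \<noteq> b\<close> by (simp add: root_reflection_def inner_diff_right dual_vector)
  also have "\<dots> < 0" using ab \<open>a \<noteq> 0\<close> by simp
  finally show False
    using simple_reflection_positive[OF a base_positive[OF b]] \<open>a \<noteq> b\<close>
      positive_coeff_ge_0[of "root_reflection a b" a] a by fastforce
qed

text \<open>Induction on the height: a positive root that is not simple has a positive inner product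
  with some simple root, and reflecting in that one lowers the height while preserving
  positivity.\<close>

lemma positive_root_conjugate_simple:
  assumes "b \<in> pos"
  shows "\<exists>as a. set as \<subseteq> \<Delta> \<and> a \<in> \<Delta> \<and> b = reflection_word as a"
proof -
  \<comment> \<open>Pairing with \<open>h\<close> is the height, the sum of all
    coefficients.\<close>
  obtain h where h: "\<And>a. a \<in> \<Delta> \<Longrightarrow> h \<bullet> a = 1" using ex_prescribed_inner[of "\<lambda>_. 1"] by blast
  have height: "h \<bullet> b \<in> \<nat>" if "b \<in> pos" for b
  proof -
    have "h \<bullet> b = (\<Sum>a\<in>\<Delta>. dual_vector a \<bullet> b)"
      by (subst positive_expansion(2)[OF that], unfold inner_sum_right) (auto simp: h)
    also have "\<dots> \<in> \<nat>" using positive_expansion(3)[OF that] by (rule sum_in_Nats)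
    finally show ?thesis .
  qed
  obtain n where "h \<bullet> b = real n" using height[OF assms] by (auto simp: Nats_def)
  with assms show ?thesis
  proof (induction n arbitrary: b rule: less_induct)
    case (less n b)
    show ?case
    proof (cases "b \<in> \<Delta>")
      case True
      then show ?thesis by (auto intro!: exI[of _ "[]"])
    next
      case False
      have "b \<bullet> b > 0" using less.prems positive_expansion(1) root_nonzero by auto
      \<comment> \<open>Only the second factor is expanded. As the total is positive, some simple
        root contributes a positive term.\<close>
      moreover have "b \<bullet> b = (\<Sum>a\<in>\<Delta>. (dual_vector a \<bullet> b) * (b \<bullet> a))"
        by (subst (2) positive_expansion(2)[OF less.prems(1)]) (simp add: inner_sum_right)
      ultimately obtain a where a: "a \<in> \<Delta>" "(dual_vector a \<bullet> b) * (b \<bullet> a) > 0"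
        using sum_nonpos[of \<Delta> "\<lambda>a. (dual_vector a \<bullet> b) * (b \<bullet> a)"] by force
      then have ba: "b \<bullet> a > 0"
        using positive_coeff_ge_0[OF less.prems(1) a(1)] by (auto simp: zero_less_mult_iff)
      have "a \<noteq> 0" using a(1) base_subset root_nonzero by blast
      let ?b = "root_reflection a b"
      have p: "?b \<in> pos" using simple_reflection_positive a(1) less.prems(1) False by blast
      have "h \<bullet> ?b < real n"
        using less.prems(2) a(1) ba \<open>a \<noteq> 0\<close> by (simp add: root_reflection_def inner_diff_right h)
      moreover obtain m where m: "h \<bullet> ?b = real m" using height[OF p] by (auto simp: Nats_def)
      ultimately obtain as c where "set as \<subseteq> \<Delta>" "c \<in> \<Delta>" "?b = reflection_word as c"
        using less.IH[of m ?b] p by auto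
      moreover from this(3) have "b = reflection_word (a # as) c"
        by (metis comp_apply list.simps(9) root_reflection_root_reflection word_prod_simps(2))
      ultimately show ?thesis using a(1) by (intro exI[of _ "a # as"] exI[of _ c]) auto
    qed
  qed
qed

lemma root_reflection_simple_word:
  assumes "b \<in> \<Phi>" shows "\<exists>as. set as \<subseteq> \<Delta> \<and> root_reflection b = reflection_word as"
proof -
  have *: "\<exists>as. set as \<subseteq> \<Delta> \<and> root_reflection b = reflection_word as" if b: "b \<in> pos" for b
  proof -
    obtain as a where "set as \<subseteq> \<Delta>" "a \<in> \<Delta>" "b = reflection_word as a"
      using positive_root_conjugate_simple[OF b] by blast
    then show ?thesis
      by (intro exI[of _ "as @ a # rev as"]) (auto simp: root_reflection_word_image o_assoc)
  qed
  from positive_or_negative[OF assms] *[of b] *[of "- b"] show ?thesis by auto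
qed

text \<open>The group is defined by the reflections in all roots. Each of them is a word in simple
  reflections, so substituting these words letter by letter suffices.\<close>

lemma weyl_group_words: "weyl_group \<Phi> = {reflection_word as |as. set as \<subseteq> \<Delta>}"
proof -
  have "\<exists>bs. set bs \<subseteq> \<Delta> \<and> reflection_word as = reflection_word bs" if "set as \<subseteq> \<Phi>" for as
    using that
  proof (induction as)
    case Nil
    show ?case by (rule exI[of _ "[]"]) simp
  next
    case (Cons a as)
    then obtain bs where "set bs \<subseteq> \<Delta>" "reflection_word as = reflection_word bs" by auto
    moreover obtain cs where "set cs \<subseteq> \<Delta>" "root_reflection a = reflection_word cs"
      using root_reflection_simple_word[of a] Cons.prems by force
    ultimately show ?case by (intro exI[of _ "cs @ bs"]) auto
  qed
  then show ?thesis
    unfolding weyl_group_def generate_reflections using base_subset by blast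
qed

section \<open>Length, exchange and deletion\<close>

lemma simple_word_set: "set ss \<subseteq> root_reflection ` \<Delta> \<longleftrightarrow> (\<exists>as. set as \<subseteq> \<Delta> \<and> ss = map root_reflection as)"
  using lists_image[of root_reflection \<Delta>] unfolding lists_eq_set by blast

lemma weyl_length_le: "set as \<subseteq> \<Delta> \<Longrightarrow> weyl_length \<Delta> (reflection_word as) \<le> length as"
  unfolding weyl_length_def by (rule Least_le) (intro exI[of _ "map root_reflection as"], auto)

lemma reduced_word:
  assumes "u \<in> weyl_group \<Phi>"
  obtains as where "set as \<subseteq> \<Delta>" "u = reflection_word as" "length as = weyl_length \<Delta> u"
proof -
  have "\<exists>n ss. set ss \<subseteq> root_reflection ` \<Delta> \<and> word_prod ss = u \<and> length ss = n"
    using assms unfolding weyl_group_words by (auto simp: simple_word_set)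
  from LeastI_ex[OF this] obtain ss where
    "set ss \<subseteq> root_reflection ` \<Delta>" "word_prod ss = u" "length ss = weyl_length \<Delta> u"
    unfolding weyl_length_def by blast
  then show thesis using that unfolding simple_word_set by auto
qed

text \<open>Read from the right, the word turns \<open>b\<close> negative at some letter
  \<open>a\<close>. A simple reflection makes only its own root negative, so the suffix carries
  \<open>b\<close> to \<open>a\<close>. The reflection in \<open>b\<close> is then conjugate through
  the suffix to that in \<open>a\<close> and cancels this letter.\<close>

lemma exchange:
  assumes "set as \<subseteq> \<Delta>" "b \<in> pos" "reflection_word as b \<notin> pos"
  shows "\<exists>xs a ys. as = xs @ a # ys \<and> reflection_word as \<circ> root_reflection b = reflection_word (xs @ ys)"
  using assms
proof (induction as)
  case (Cons a as)
  show ?case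
  proof (cases "reflection_word as b \<in> pos")
    case True
    then have "reflection_word as b = a"
      using simple_reflection_positive[of a "reflection_word as b"] Cons.prems by auto
    then have "root_reflection a = reflection_word as \<circ> root_reflection b \<circ> reflection_word (rev as)"
      using root_reflection_word_image by metis
    then have "reflection_word as \<circ> root_reflection b = root_reflection a \<circ> reflection_word as"
      by (simp add: fun_eq_iff)
    then have "reflection_word (a # as) \<circ> root_reflection b =
        (root_reflection a \<circ> root_reflection a) \<circ> reflection_word as"
      by (simp only: list.map word_prod_simps comp_assoc)
    then have "reflection_word (a # as) \<circ> root_reflection b = reflection_word as"
      by (simp only: root_reflection_comp_self id_comp)
    then show ?thesis
      by (intro exI[of _ "[]"] exI[of _ a] exI[of _ as]) (simp only: append_Nil simp_thms)
  next
    case False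
    then obtain xs c ys where "as = xs @ c # ys"
      "reflection_word as \<circ> root_reflection b = reflection_word (xs @ ys)"
      using Cons.IH[OF _ Cons.prems(2)] Cons.prems(1)
      unfolding set_simps insert_subset by blast
    then show ?thesis
      by (intro exI[of _ "a # xs"] exI[of _ c] exI[of _ ys])
        (simp only: append_Cons list.map word_prod_simps comp_assoc simp_thms)
  qed
qed simp

lemma bruhat_step_deletion:
  assumes "bruhat_step \<Phi> \<Delta> u (reflection_word as)" "set as \<subseteq> \<Delta>"
  shows "\<exists>xs a ys. as = xs @ a # ys \<and> u = reflection_word (xs @ ys)"
proof -
  from assms obtain b where u: "u \<in> weyl_group \<Phi>" and "b \<in> \<Phi>"
    and v: "reflection_word as = u \<circ> root_reflection b"
    and less: "weyl_length \<Delta> u < weyl_length \<Delta> (reflection_word as)"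
    unfolding bruhat_step_def by blast
  \<comment> \<open>A root and its negative give the same reflection, so the root may be taken
    positive, as \<open>exchange\<close> requires.\<close>
  obtain c where c: "c \<in> pos" "root_reflection b = root_reflection c"
    using positive_or_negative[OF \<open>b \<in> \<Phi>\<close>] root_reflection_uminus[of b, symmetric] by blast
  have u_eq: "u = reflection_word as \<circ> root_reflection c"
    unfolding v c(2) by (simp only: comp_assoc root_reflection_comp_self comp_id)
  show ?thesis
  proof (cases "reflection_word as c \<in> pos")
    case True
    \<comment> \<open>This case is impossible: \<open>u\<close> makes \<open>c\<close> negative, so
      exchange in a reduced word for \<open>u\<close> would write the upper element as a word
      shorter than the length of \<open>u\<close>.\<close>
    obtain bs where bs: "set bs \<subseteq> \<Delta>" "u = reflection_word bs" "length bs = weyl_length \<Delta> u"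
      using reduced_word[OF u] .
    have "c \<noteq> 0" using c positive_expansion(1) root_nonzero by blast
    then have "u c = - reflection_word as c"
      by (simp add: u_eq root_reflection_self linear_neg[OF linear_reflection_word])
    then have "reflection_word bs c \<notin> pos"
      using not_both_positive[OF True] unfolding bs(2)[symmetric] by (simp only: not_False_eq_True)
    from exchange[OF bs(1) c(1) this] obtain xs a ys where
      "bs = xs @ a # ys" "u \<circ> root_reflection c = reflection_word (xs @ ys)"
      unfolding bs(2) by blast
    then have "weyl_length \<Delta> (reflection_word as) \<le> length (xs @ ys)"
      using weyl_length_le[of "xs @ ys"] bs(1) unfolding v c(2) by auto
    also have "\<dots> < weyl_length \<Delta> u" using bs(3) \<open>bs = _\<close> by simp
    finally show ?thesis using less by simp
  next
    case False
    from exchange[OF assms(2) c(1) this] show ?thesis unfolding u_eq .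
  qed
qed

subsection \<open>Products of distinct simple reflections\<close>

text \<open>
  For a word with distinct letters this says that no letter in \<open>I\<close> can be moved to the end.
\<close>

fun no_final_letter :: "'a set \<Rightarrow> 'a list \<Rightarrow> bool" where
  "no_final_letter I [] \<longleftrightarrow> True"
| "no_final_letter I (b # bs) \<longleftrightarrow>
     no_final_letter I bs \<and> (b \<in> I \<longrightarrow> (\<exists>c\<in>set bs. b \<bullet> c \<noteq> 0))"

lemma final_letter:
  assumes "\<not> no_final_letter I bs"
  obtains xs b ys where "bs = xs @ b # ys" "b \<in> I" "\<forall>c\<in>set ys. b \<bullet> c = 0"
  using assms
proof (induction bs arbitrary: thesis)
  case (Cons b bs)
  show ?case
  proof (cases "no_final_letter I bs")
    case True
    then show ?thesis using Cons.prems(1)[of "[]" b bs] Cons.prems(2) by auto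
  next
    case False
    then obtain xs c ys where "bs = xs @ c # ys" "c \<in> I" "\<forall>d\<in>set ys. c \<bullet> d = 0"
      using Cons.IH by blast
    then show ?thesis using Cons.prems(1)[of "b # xs" c ys] by auto
  qed
qed simp

text \<open>
  An antidominant vector moves by a nonnegative combination of the letters: since distinct simple
  roots are at obtuse angles, contributions never cancel.
\<close>

lemma distinct_word_antidominant:
  assumes "set bs \<subseteq> \<Delta>" "distinct bs" "no_final_letter I bs"
    and x: "\<And>a. a \<in> \<Delta> \<Longrightarrow> x \<bullet> a = (if a \<in> I then 0 else - 1)"
  shows "\<exists>d. (\<forall>a\<in>set bs. d a > 0) \<and> reflection_word bs x = x + (\<Sum>a\<in>set bs. d a *\<^sub>R a)"
  using assms(1-3)
proof (induction bs)
  case (Cons b bs)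
  then obtain d where d: "\<And>a. a \<in> set bs \<Longrightarrow> d a > 0"
      "reflection_word bs x = x + (\<Sum>a\<in>set bs. d a *\<^sub>R a)"
    by auto
  have b: "b \<in> \<Delta>" "b \<notin> set bs" "b \<bullet> b > 0"
    using Cons.prems base_subset root_nonzero[of b] by auto
  have bs: "d a * (a \<bullet> b) \<le> 0" if "a \<in> set bs" for a
    using base_obtuse[of a b] that Cons.prems d(1)[OF that] by (force simp: mult_le_0_iff)
  let ?y = "reflection_word bs x"
  have y: "?y \<bullet> b = x \<bullet> b + (\<Sum>a\<in>set bs. d a * (a \<bullet> b))"
    by (simp add: d(2) inner_add_left inner_sum_left)
  \<comment> \<open>Outside \<open>I\<close> the strictness comes from the value -1 of
    \<open>x\<close>. Inside \<open>I\<close>, where \<open>x\<close> contributes 0, it comes from a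
    later letter not orthogonal to \<open>b\<close>.\<close>
  have "?y \<bullet> b < 0"
  proof (cases "b \<in> I")
    case True
    then obtain c where c: "c \<in> set bs" "b \<bullet> c \<noteq> 0" using Cons.prems by auto
    then have "d c * (c \<bullet> b) < 0"
      using bs[OF c(1)] d(1)[OF c(1)] by (simp add: inner_commute less_le)
    with bs c(1) have "(\<Sum>a\<in>set bs. d a * (a \<bullet> b)) < 0"
      using sum_strict_mono_ex1[of "set bs" "\<lambda>a. d a * (a \<bullet> b)" "\<lambda>_. 0"] by auto
    then show ?thesis using y x[OF b(1)] True by simp
  next
    case False
    then show ?thesis using y x[OF b(1)] sum_nonpos[of "set bs" "\<lambda>a. d a * (a \<bullet> b)"] bs by simp
  qed
  \<comment> \<open>The coefficient that the reflection in \<open>b\<close> adds at the new letter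
    \<open>b\<close>; the coefficients of the letters of \<open>bs\<close> stay as they
    were.\<close>
  moreover define k where "k = - (2 * (?y \<bullet> b) / (b \<bullet> b))"
  ultimately have pos: "k > 0" using b(3) by (simp add: divide_less_0_iff)
  define d' where "d' = d(b := k)"
  have "(\<Sum>a\<in>set bs. d' a *\<^sub>R a) = (\<Sum>a\<in>set bs. d a *\<^sub>R a)"
    using b(2) by (intro sum.cong) (auto simp: d'_def)
  then have "(\<Sum>a\<in>set (b # bs). d' a *\<^sub>R a) =
      k *\<^sub>R b + (\<Sum>a\<in>set bs. d a *\<^sub>R a)"
    using b(2) by (simp add: d'_def)
  moreover have "reflection_word (b # bs) x = ?y + k *\<^sub>R b"
    by (simp add: root_reflection_def k_def)
  ultimately have "reflection_word (b # bs) x = x + (\<Sum>a\<in>set (b # bs). d' a *\<^sub>R a)"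
    unfolding d(2) by (simp only: add.assoc add.commute add.left_commute)
  moreover have "\<forall>a\<in>set (b # bs). d' a > 0" using d(1) pos b(2) by (auto simp: d'_def)
  ultimately show ?case by (intro exI[of _ d'] conjI)
qed simp

text \<open>Evaluate both sides at an antidominant vector \<open>x\<close> that is orthogonal to
  \<open>I\<close> and hence fixed by \<open>us\<close>. The left side moves \<open>x\<close> with a
  positive coefficient at each letter of \<open>bs\<close>, and a word without a letter cannot
  change the coefficient at that letter.\<close>

lemma letters_subset:
  assumes "set bs \<subseteq> \<Delta>" "distinct bs" "no_final_letter I bs" "I \<subseteq> \<Delta>" "set us \<subseteq> I"
    and "set cs \<subseteq> \<Delta>" "reflection_word bs \<circ> reflection_word us = reflection_word cs"
  shows "set bs \<subseteq> set cs"
proof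
  fix b assume b: "b \<in> set bs"
  obtain x where x: "\<And>a. a \<in> \<Delta> \<Longrightarrow> x \<bullet> a = (if a \<in> I then 0 else - 1)"
    using ex_prescribed_inner[of "\<lambda>a. if a \<in> I then 0 else - 1"] by blast
  obtain d where d: "\<And>a. a \<in> set bs \<Longrightarrow> d a > 0"
      "reflection_word bs x = x + (\<Sum>a\<in>set bs. d a *\<^sub>R a)"
    using distinct_word_antidominant[OF assms(1-3) x] by blast
  have "reflection_word us x = x"
    using assms(4,5) by (intro reflection_word_fixes ballI) (subst x, auto)
  then have "reflection_word cs x - x = (\<Sum>a\<in>set bs. d a *\<^sub>R a)"
    using fun_cong[OF assms(7), of x] unfolding comp_apply d(2) by (simp add: d(2) algebra_simps)
  then have coeff: "dual_vector b \<bullet> (reflection_word cs x - x) = d b"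
    using dual_vector_sum[of b "set bs" d] b assms(1) by auto
  show "b \<in> set cs"
  proof (rule ccontr)
    assume "b \<notin> set cs"
    then have "orthogonal (dual_vector b) c" if "c \<in> set cs" for c
      using that assms(6) dual_vector[of c b] by (auto simp: orthogonal_def)
    then have "orthogonal (dual_vector b) (reflection_word cs x - x)"
      using orthogonal_to_span[OF reflection_word_diff_span[of cs x]] by blast
    with coeff d(1)[OF b] show False by (simp add: orthogonal_def)
  qed
qed

section \<open>Lengths and minimal coset representatives\<close>

lemma no_final_letter_empty [simp]: "no_final_letter {} bs"
  by (induction bs) auto

lemma length_le_if_letters_subset:
  assumes "distinct bs" "set bs \<subseteq> set cs" shows "length bs \<le> length cs"
  using assms by (metis List.finite_set card_length card_mono distinct_card le_trans)

text \<open>A reduced word for the product has to contain every letter of \<open>bs\<close>, and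
  these are distinct.\<close>

lemma weyl_length_ge:
  assumes "set bs \<subseteq> \<Delta>" "distinct bs" "no_final_letter I bs" "I \<subseteq> \<Delta>" "set us \<subseteq> I"
  shows "length bs \<le> weyl_length \<Delta> (reflection_word bs \<circ> reflection_word us)"
proof -
  have "reflection_word bs \<circ> reflection_word us \<in> weyl_group \<Phi>"
    unfolding weyl_group_words mem_Collect_eq using assms
    by (intro exI[of _ "bs @ us"]) (auto simp only: map_append word_prod_append set_append)
  then obtain cs where "set cs \<subseteq> \<Delta>" "reflection_word bs \<circ> reflection_word us = reflection_word cs"
    "length cs = weyl_length \<Delta> (reflection_word bs \<circ> reflection_word us)"
    by (rule reduced_word)
  then show ?thesis
    using length_le_if_letters_subset[OF assms(2) letters_subset[OF assms, of cs]] by simp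
qed

text \<open>The case of empty \<open>I\<close> and empty \<open>us\<close>, where the condition on
  final letters is vacuous: words with distinct letters are reduced.\<close>

lemma weyl_length_distinct_word:
  assumes "set bs \<subseteq> \<Delta>" "distinct bs"
  shows "weyl_length \<Delta> (reflection_word bs) = length bs"
  using weyl_length_le[OF assms(1)] weyl_length_ge[OF assms no_final_letter_empty, of "[]"]
  by simp

lemma distinct_word_letters:
  assumes "set bs \<subseteq> \<Delta>" "distinct bs" "set cs \<subseteq> \<Delta>" "distinct cs"
    and "reflection_word bs = reflection_word cs"
  shows "set bs = set cs"
proof
  show "set bs \<subseteq> set cs"
    by (rule letters_subset[OF assms(1,2) no_final_letter_empty, of "[]"]) (simp_all add: assms)
  show "set cs \<subseteq> set bs"
    by (rule letters_subset[OF assms(3,4) no_final_letter_empty, of "[]"]) (simp_all add: assms)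
qed

text \<open>One direction is the length bound. For the other, an offending letter of
  \<open>I\<close> commutes with everything after it, so multiplying by it on the right cancels it
  and shortens the word.\<close>

lemma distinct_word_min_coset_rep:
  assumes "set bs \<subseteq> \<Delta>" "distinct bs"
  shows "reflection_word bs \<in> min_coset_reps \<Phi> \<Delta> \<Psi> \<longleftrightarrow> no_final_letter {a\<in>\<Delta>. - a \<in> \<Psi>} bs"
    (is "_ \<longleftrightarrow> no_final_letter ?I bs")
proof
  have len: "weyl_length \<Delta> (reflection_word bs) = length bs"
    by (rule weyl_length_distinct_word[OF assms])
  have W: "reflection_word bs \<in> weyl_group \<Phi>" using assms unfolding weyl_group_words by blast
  show "reflection_word bs \<in> min_coset_reps \<Phi> \<Delta> \<Psi>" if "no_final_letter ?I bs"
    unfolding min_coset_reps_def parabolic_weyl_def generate_reflections len mem_Collect_eq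
  proof (intro conjI ballI W)
    fix u assume "u \<in> {reflection_word as |as. set as \<subseteq> ?I}"
    then obtain us where "set us \<subseteq> ?I" "u = reflection_word us" by blast
    then show "length bs \<le> weyl_length \<Delta> (reflection_word bs \<circ> u)"
      using weyl_length_ge[OF assms that, of us] by auto
  qed
  show "no_final_letter ?I bs" if min: "reflection_word bs \<in> min_coset_reps \<Phi> \<Delta> \<Psi>"
  proof (rule ccontr)
    assume "\<not> no_final_letter ?I bs"
    then obtain xs b ys where bs: "bs = xs @ b # ys" "b \<in> ?I" "\<forall>c\<in>set ys. b \<bullet> c = 0"
      by (rule final_letter)
    have "reflection_word bs \<circ> root_reflection b =
        reflection_word xs \<circ> (root_reflection b \<circ> (reflection_word ys \<circ> root_reflection b))"
      by (simp only: bs(1) map_append list.map word_prod_append word_prod_simps comp_assoc)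
    also have "reflection_word ys \<circ> root_reflection b = root_reflection b \<circ> reflection_word ys"
      by (rule reflection_word_comm[OF bs(3)])
    also have "root_reflection b \<circ> (root_reflection b \<circ> reflection_word ys) = reflection_word ys"
      by (simp only: comp_assoc[symmetric] root_reflection_comp_self id_comp)
    finally have "reflection_word bs \<circ> root_reflection b = reflection_word (xs @ ys)"
      by (simp only: map_append word_prod_append)
    moreover have "root_reflection b \<in> parabolic_weyl \<Delta> \<Psi>"
      unfolding parabolic_weyl_def by (intro generate.incl imageI bs(2))
    ultimately have "length bs \<le> weyl_length \<Delta> (reflection_word (xs @ ys))"
      using min unfolding min_coset_reps_def mem_Collect_eq len by metis
    also have "\<dots> \<le> length (xs @ ys)" using bs(1) assms(1) by (intro weyl_length_le) auto
    finally show False using bs(1) by simp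
  qed
qed

lemma bruhat_step_insert:
  assumes "set (xs @ a # ys) \<subseteq> \<Delta>" "distinct (xs @ a # ys)"
  shows "bruhat_step \<Phi> \<Delta> (reflection_word (xs @ ys)) (reflection_word (xs @ a # ys))"
proof -
  \<comment> \<open>Inserting \<open>a\<close> before \<open>ys\<close> amounts to multiplying on
    the right by the reflection in this root, the conjugate of that in \<open>a\<close> by
    \<open>ys\<close>.\<close>
  let ?b = "reflection_word (rev ys) a"
  have "reflection_word (xs @ a # ys) = reflection_word (xs @ ys) \<circ> root_reflection ?b"
    unfolding root_reflection_word_image rev_rev_ident by (simp add: fun_eq_iff)
  moreover have "?b \<in> \<Phi>" using assms(1) base_subset by (intro reflection_word_root) auto
  moreover have "reflection_word (xs @ ys) \<in> weyl_group \<Phi>"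
    unfolding weyl_group_words using assms(1) by (intro CollectI exI[of _ "xs @ ys"]) auto
  moreover have "weyl_length \<Delta> (reflection_word (xs @ ys)) < weyl_length \<Delta> (reflection_word (xs @ a # ys))"
    using assms by (subst (1 2) weyl_length_distinct_word) auto
  ultimately show ?thesis unfolding bruhat_step_def by blast
qed

end

subsection \<open>Lattices of sets with union as join\<close>

text \<open>Working through the encoding \<open>f\<close> lets the Bruhat interval be treated
  directly, without transporting lattice operations along an isomorphism. \<open>F\<close> need not
  be closed under intersection: the meet is the largest member inside it, which
  \<open>interior\<close> provides.\<close>

locale set_lattice =
  fixes L :: "('a, 'c) gorder_scheme" (structure) and f :: "'a \<Rightarrow> 'e set" and F :: "'e set set"
  assumes eq: "eq L = (=)"
    and bij: "bij_betw f (carrier L) F"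
    and le: "\<And>x y. x \<in> carrier L \<Longrightarrow> y \<in> carrier L \<Longrightarrow> x \<sqsubseteq> y \<longleftrightarrow> f x \<subseteq> f y"
    and union: "\<And>A B. A \<in> F \<Longrightarrow> B \<in> F \<Longrightarrow> A \<union> B \<in> F"
    and interior: "\<And>A B. A \<in> F \<Longrightarrow> B \<in> F \<Longrightarrow> \<exists>C\<in>F. C \<subseteq> A \<inter> B \<and> (\<forall>D\<in>F. D \<subseteq> A \<inter> B \<longrightarrow> D \<subseteq> C)"
begin

lemma f_in: "x \<in> carrier L \<Longrightarrow> f x \<in> F"
  using bij by (auto simp: bij_betw_def)

lemma f_eq: "x \<in> carrier L \<Longrightarrow> y \<in> carrier L \<Longrightarrow> f x = f y \<longleftrightarrow> x = y"
  using bij by (auto simp: bij_betw_def inj_on_def)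

lemma f_surj: "A \<in> F \<Longrightarrow> \<exists>x\<in>carrier L. f x = A"
  using bij by (auto simp: bij_betw_def)

lemma partial_order: "partial_order L"
  by unfold_locales (auto simp: eq le f_eq[symmetric])

lemma less_iff: "x \<in> carrier L \<Longrightarrow> y \<in> carrier L \<Longrightarrow> x \<sqsubset> y \<longleftrightarrow> f x \<subset> f y"
  using f_eq by (auto simp: lless_def eq le)

lemma Upper_pair:
  "x \<in> carrier L \<Longrightarrow> y \<in> carrier L \<Longrightarrow> Upper L {x, y} = {u \<in> carrier L. x \<sqsubseteq> u \<and> y \<sqsubseteq> u}"
  and Lower_pair:
  "x \<in> carrier L \<Longrightarrow> y \<in> carrier L \<Longrightarrow> Lower L {x, y} = {u \<in> carrier L. u \<sqsubseteq> x \<and> u \<sqsubseteq> y}"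
  by (auto simp: Upper_def Lower_def)

lemma is_lub_iff_union:
  assumes "x \<in> carrier L" "y \<in> carrier L"
  shows "least L z (Upper L {x, y}) \<longleftrightarrow> z \<in> carrier L \<and> f z = f x \<union> f y"
proof -
  obtain u where u: "u \<in> carrier L" "f u = f x \<union> f y"
    using f_surj[OF union] f_in assms by metis
  show ?thesis
  proof
    assume "least L z (Upper L {x, y})"
    then have z: "z \<in> carrier L" "x \<sqsubseteq> z" "y \<sqsubseteq> z"
      "\<And>v. v \<in> carrier L \<Longrightarrow> x \<sqsubseteq> v \<Longrightarrow> y \<sqsubseteq> v \<Longrightarrow> z \<sqsubseteq> v"
      using assms by (simp_all add: least_def Upper_pair)
    from z(4)[of u] u assms z(1) have "f z \<subseteq> f x \<union> f y" by (simp add: le)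
    with z assms show "z \<in> carrier L \<and> f z = f x \<union> f y" by (auto simp: le)
  next
    assume z: "z \<in> carrier L \<and> f z = f x \<union> f y"
    have "z \<sqsubseteq> u" if "u \<in> carrier L" "x \<sqsubseteq> u" "y \<sqsubseteq> u" for u
      using that z assms by (simp add: le)
    moreover have "x \<sqsubseteq> z" "y \<sqsubseteq> z" using z assms by (simp_all add: le)
    ultimately show "least L z (Upper L {x, y})"
      unfolding least_def Upper_pair[OF assms] using z by blast
  qed
qed

lemma is_glb_iff_interior:
  assumes "x \<in> carrier L" "y \<in> carrier L"
  shows "greatest L z (Lower L {x, y}) \<longleftrightarrow>
    z \<in> carrier L \<and> f z \<subseteq> f x \<inter> f y \<and> (\<forall>D\<in>F. D \<subseteq> f x \<inter> f y \<longrightarrow> D \<subseteq> f z)"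
proof
  assume "greatest L z (Lower L {x, y})"
  then have z: "z \<in> carrier L" "z \<sqsubseteq> x" "z \<sqsubseteq> y"
    "\<And>u. u \<in> carrier L \<Longrightarrow> u \<sqsubseteq> x \<Longrightarrow> u \<sqsubseteq> y \<Longrightarrow> u \<sqsubseteq> z"
    using assms by (simp_all add: greatest_def Lower_pair)
  have "D \<subseteq> f z" if D: "D \<in> F" "D \<subseteq> f x \<inter> f y" for D
  proof -
    obtain u where "u \<in> carrier L" "f u = D" using f_surj[OF D(1)] by blast
    then show ?thesis using z(4)[of u] D(2) assms z(1) by (simp add: le)
  qed
  then show "z \<in> carrier L \<and> f z \<subseteq> f x \<inter> f y \<and> (\<forall>D\<in>F. D \<subseteq> f x \<inter> f y \<longrightarrow> D \<subseteq> f z)"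
    using z assms by (auto simp: le)
next
  assume z: "z \<in> carrier L \<and> f z \<subseteq> f x \<inter> f y \<and> (\<forall>D\<in>F. D \<subseteq> f x \<inter> f y \<longrightarrow> D \<subseteq> f z)"
  have "u \<sqsubseteq> z" if "u \<in> carrier L" "u \<sqsubseteq> x" "u \<sqsubseteq> y" for u
    using that z assms f_in[of u] by (simp add: le)
  moreover have "z \<sqsubseteq> x" "z \<sqsubseteq> y" using z assms by (simp_all add: le)
  ultimately show "greatest L z (Lower L {x, y})"
    unfolding greatest_def Lower_pair[OF assms] using z by blast
qed

lemma lattice: "lattice L"
proof -
  interpret partial_order L by (rule partial_order)
  show ?thesis
  proof
    fix x y assume xy: "x \<in> carrier L" "y \<in> carrier L"
    show "\<exists>s. least L s (Upper L {x, y})"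
      unfolding is_lub_iff_union[OF xy] using f_surj[OF union[OF f_in[OF xy(1)] f_in[OF xy(2)]]] by blast
    from interior[OF f_in[OF xy(1)] f_in[OF xy(2)]]
    obtain C where C: "C \<in> F" "C \<subseteq> f x \<inter> f y" "\<forall>D\<in>F. D \<subseteq> f x \<inter> f y \<longrightarrow> D \<subseteq> C" by blast
    then obtain z where "z \<in> carrier L" "f z = C" using f_surj by blast
    with C show "\<exists>s. greatest L s (Lower L {x, y})"
      unfolding is_glb_iff_interior[OF xy] by auto
  qed
qed

lemma join:
  assumes "x \<in> carrier L" "y \<in> carrier L"
  shows "x \<squnion> y \<in> carrier L" "f (x \<squnion> y) = f x \<union> f y"
proof -
  interpret lattice L by (rule lattice)
  show "x \<squnion> y \<in> carrier L" "f (x \<squnion> y) = f x \<union> f y"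
    using sup_of_two_least[OF assms] unfolding is_lub_iff_union[OF assms] join_def by auto
qed

lemma meet:
  assumes "x \<in> carrier L" "y \<in> carrier L"
  shows "x \<sqinter> y \<in> carrier L" "f (x \<sqinter> y) \<subseteq> f x \<inter> f y"
    "D \<in> F \<Longrightarrow> D \<subseteq> f x \<inter> f y \<Longrightarrow> D \<subseteq> f (x \<sqinter> y)"
proof -
  interpret lattice L by (rule lattice)
  show "x \<sqinter> y \<in> carrier L" "f (x \<sqinter> y) \<subseteq> f x \<inter> f y"
    "D \<in> F \<Longrightarrow> D \<subseteq> f x \<inter> f y \<Longrightarrow> D \<subseteq> f (x \<sqinter> y)"
    using inf_of_two_greatest[OF assms] unfolding is_glb_iff_interior[OF assms] meet_def by auto
qed

lemma meet_eq_Int: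
  assumes "x \<in> carrier L" "y \<in> carrier L" "f x \<inter> f y \<in> F"
  shows "f (x \<sqinter> y) = f x \<inter> f y"
  using meet(2)[OF assms(1,2)] meet(3)[OF assms] by blast

text \<open>Inside a ring of sets contained in \<open>F\<close>, meets are true intersections, so
  distributivity is that of sets.\<close>

lemma distributive_onI:
  assumes "K \<subseteq> carrier L" "f ` K \<subseteq> R" "R \<subseteq> F"
    and "\<And>A B. A \<in> R \<Longrightarrow> B \<in> R \<Longrightarrow> A \<inter> B \<in> R" "\<And>A B. A \<in> R \<Longrightarrow> B \<in> R \<Longrightarrow> A \<union> B \<in> R"
  shows "distributive_on L K"
  unfolding distributive_on_def
proof (intro ballI)
  fix x y z assume xyz: "x \<in> K" "y \<in> K" "z \<in> K"
  then have c: "x \<in> carrier L" "y \<in> carrier L" "z \<in> carrier L"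
    and R: "f x \<in> R" "f y \<in> R" "f z \<in> R" using assms by auto
  have "f (x \<sqinter> (y \<squnion> z)) = f x \<inter> (f y \<union> f z)"
    using c R assms(3-5) by (subst meet_eq_Int) (auto simp: join subset_iff)
  moreover have "f (x \<sqinter> y) = f x \<inter> f y" "f (x \<sqinter> z) = f x \<inter> f z"
    using c R assms(3) assms(4)[of "f x"] by (simp_all add: meet_eq_Int subset_iff)
  then have "f ((x \<sqinter> y) \<squnion> (x \<sqinter> z)) = (f x \<inter> f y) \<union> (f x \<inter> f z)"
    using c by (simp add: join meet)
  ultimately show "x \<sqinter> (y \<squnion> z) = (x \<sqinter> y) \<squnion> (x \<sqinter> z)"
    using f_eq c by (simp add: Int_Un_distrib meet join flip: f_eq)
qed

lemma boolean_latticeI: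
  assumes F: "F = {A. X \<subseteq> A \<and> A \<subseteq> Y}" and "X \<subseteq> Y"
  shows "boolean_lattice L"
proof -
  interpret lattice L by (rule lattice)
  obtain x y where xy: "x \<in> carrier L" "f x = X" "y \<in> carrier L" "f y = Y"
    using f_surj[of X] f_surj[of Y] assms by auto
  have bounds: "X \<subseteq> f z \<and> f z \<subseteq> Y" if "z \<in> carrier L" for z
    using f_in[OF that] F by auto
  interpret bounded_lattice L
  proof
    show "\<exists>b. least L b (carrier L)"
      using xy bounds by (intro exI[of _ x]) (auto simp: least_def le)
    show "\<exists>t. greatest L t (carrier L)"
      using xy bounds by (intro exI[of _ y]) (auto simp: greatest_def le)
  qed
  have bot: "\<bottom> = x" and top: "\<top> = y"
    using bottom_eq[of x] top_eq[of y] xy bounds by (auto simp: le)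
  have "\<exists>z'\<in>carrier L. z \<sqinter> z' = \<bottom> \<and> z \<squnion> z' = \<top>" if z: "z \<in> carrier L" for z
  proof -
    \<comment> \<open>The relative complement: the part of \<open>Y\<close> missing from
      \<open>f z\<close>, with the bottom \<open>X\<close> put back.\<close>
    obtain z' where z': "z' \<in> carrier L" "f z' = X \<union> (Y - f z)"
      using f_surj[of "X \<union> (Y - f z)"] F assms(2) by auto
    have "f (z \<sqinter> z') = f z \<inter> f z'"
      using z z' bounds[OF z] by (intro meet_eq_Int) (auto simp: F)
    then have "f (z \<sqinter> z') = f x" "f (z \<squnion> z') = f y"
      using z z' bounds[OF z] assms(2) xy by (auto simp: join)
    then show ?thesis
      using z z' xy by (intro bexI[of _ z']) (auto simp: bot top f_eq)
  qed
  moreover have "distributive_on L (carrier L)"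
    using f_in by (intro distributive_onI[of _ F]) (auto simp: F)
  ultimately show ?thesis
    unfolding boolean_lattice_def using bounded_lattice_axioms by blast
qed

end

subsection \<open>Supersolvable antimatroids\<close>

lemma linear_order_on_finite_min:
  assumes "linear_order_on E r" "finite S" "S \<noteq> {}" "S \<subseteq> E"
  shows "\<exists>x\<in>S. \<forall>y\<in>S. (x, y) \<in> r"
  using assms(2-4)
proof (induction S rule: finite_ne_induct)
  case (singleton x)
  then show ?case using assms(1) by (auto simp: order_on_defs refl_on_def)
next
  case (insert x S)
  then obtain m where m: "m \<in> S" "\<forall>y\<in>S. (m, y) \<in> r" by auto
  have r: "refl_on E r" "trans r" "total_on E r" using assms(1) by (auto simp: order_on_defs)
  have "x \<noteq> m" "x \<in> E" "m \<in> E" using insert m by auto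
  then consider "(x, m) \<in> r" | "(m, x) \<in> r" using r(3) unfolding total_on_def by blast
  then show ?case
  proof cases
    case 1
    then have "\<forall>y\<in>insert x S. (x, y) \<in> r"
      using m(2) r \<open>x \<in> E\<close> by (auto simp: refl_on_def dest: transD)
    then show ?thesis by blast
  next
    case 2
    then show ?thesis using m by blast
  qed
qed

locale armstrong_antimatroid =
  fixes E :: "'e set" and F :: "'e set set" and r :: "'e rel"
  assumes antimatroid: "supersolvable_antimatroid E F r"
begin

lemma finite_E: "finite E" and linear_order: "linear_order_on E r" and F_subset: "F \<subseteq> Pow E"
  and empty_feasible: "{} \<in> F"
  using antimatroid by (auto simp: supersolvable_antimatroid_def)

lemma finite_F: "finite F"
  using finite_E F_subset by (meson finite_Pow_iff finite_subset)

lemma finite_feasible: "A \<in> F \<Longrightarrow> finite A"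
  using finite_E F_subset finite_subset by blast

lemma r_antisym: "(x, y) \<in> r \<Longrightarrow> (y, x) \<in> r \<Longrightarrow> x = y"
  and r_trans: "(x, y) \<in> r \<Longrightarrow> (y, z) \<in> r \<Longrightarrow> (x, z) \<in> r"
  and r_refl: "x \<in> E \<Longrightarrow> (x, x) \<in> r"
  and r_total: "x \<in> E \<Longrightarrow> y \<in> E \<Longrightarrow> (x, y) \<in> r \<or> (y, x) \<in> r"
proof -
  have r: "refl_on E r" "trans r" "antisym r" "total_on E r"
    using linear_order by (auto simp: order_on_defs)
  show "(x, y) \<in> r \<Longrightarrow> (y, x) \<in> r \<Longrightarrow> x = y" by (rule antisymD[OF r(3)])
  show "(x, y) \<in> r \<Longrightarrow> (y, z) \<in> r \<Longrightarrow> (x, z) \<in> r" by (rule transD[OF r(2)])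
  show refl: "(x, x) \<in> r" if "x \<in> E" for x by (rule refl_onD[OF r(1) that])
  show "(x, y) \<in> r \<or> (y, x) \<in> r" if "x \<in> E" "y \<in> E"
    using r(4) refl that by (cases "x = y") (auto simp: total_on_def)
qed

lemma insert_min:
  assumes "A \<in> F" "B \<in> F" "\<not> B \<subseteq> A"
  obtains x where "x \<in> B - A" "\<forall>y\<in>B - A. (x, y) \<in> r" "insert x A \<in> F"
proof -
  have "B - A \<subseteq> E" using assms F_subset by blast
  then obtain x where x: "x \<in> B - A" "\<forall>y\<in>B - A. (x, y) \<in> r"
    using linear_order_on_finite_min[OF linear_order, of "B - A"] finite_feasible[OF assms(2)] assms(3)
    by auto
  with antimatroid assms have "insert x A \<in> F" unfolding supersolvable_antimatroid_def by blast
  with x that show thesis by blast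
qed

text \<open>By finiteness there is a maximal feasible set with \<open>P\<close>. It has no
  one-element extension of this kind, so it is the target \<open>T\<close>.\<close>

lemma grow_feasible:
  assumes "P A0" "A0 \<in> F"
    and step: "\<And>A. A \<in> F \<Longrightarrow> P A \<Longrightarrow> A \<noteq> T \<Longrightarrow> \<exists>x. x \<notin> A \<and> insert x A \<in> F \<and> P (insert x A)"
  shows "T \<in> F"
proof -
  have "finite {A \<in> F. P A}" "{A \<in> F. P A} \<noteq> {}" using finite_F assms by auto
  from finite_has_maximal[OF this] obtain A where A: "A \<in> F" "P A"
    and max: "\<And>B. B \<in> F \<Longrightarrow> P B \<Longrightarrow> A \<subseteq> B \<Longrightarrow> A = B" by auto
  have "A = T"
  proof (rule ccontr)
    assume "A \<noteq> T"
    then obtain x where "x \<notin> A" "insert x A \<in> F" "P (insert x A)" using step A by blast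
    with max[of "insert x A"] show False by blast
  qed
  with A show ?thesis by simp
qed

text \<open>Starting from \<open>A\<close>, keep adding the least missing element of
  \<open>B\<close>.\<close>

lemma union_feasible:
  assumes A: "A \<in> F" and B: "B \<in> F"
  shows "A \<union> B \<in> F"
proof (rule grow_feasible[of "\<lambda>C. A \<subseteq> C \<and> C \<subseteq> A \<union> B" A])
  fix C assume C: "C \<in> F" "A \<subseteq> C \<and> C \<subseteq> A \<union> B" "C \<noteq> A \<union> B"
  then have "\<not> B \<subseteq> C" by blast
  from insert_min[OF C(1) B this] obtain x where "x \<in> B - C" "insert x C \<in> F" by blast
  then show "\<exists>x. x \<notin> C \<and> insert x C \<in> F \<and> A \<subseteq> insert x C \<and> insert x C \<subseteq> A \<union> B"
    using C(2) by (intro exI[of _ x]) blast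
qed (use A in auto)

lemma Union_feasible:
  assumes "U \<subseteq> F" shows "\<Union>U \<in> F"
proof -
  have "finite U" using assms finite_F finite_subset by blast
  then show ?thesis using assms
    by (induction U) (auto simp: empty_feasible union_feasible)
qed

text \<open>Grow from the empty set towards \<open>X\<close>. While part of \<open>D\<close> is
  missing, the least missing element of \<open>X\<close> precedes a missing element of
  \<open>D\<close>, so it lies in \<open>D\<close> as well.\<close>

lemma initial_segment_feasible:
  assumes X: "X \<in> F" and D: "D \<subseteq> X" "\<And>x y. x \<in> D \<Longrightarrow> y \<in> X \<Longrightarrow> (y, x) \<in> r \<Longrightarrow> y \<in> D"
  shows "D \<in> F"
proof (rule grow_feasible[of "\<lambda>A. A \<subseteq> D" "{}"])
  fix A assume A: "A \<in> F" "A \<subseteq> D" "A \<noteq> D"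
  then have "\<not> X \<subseteq> A" using D(1) by blast
  from insert_min[OF A(1) X this] obtain x
    where x: "x \<in> X - A" "\<forall>y\<in>X - A. (x, y) \<in> r" "insert x A \<in> F" by blast
  obtain d where d: "d \<in> D - A" using A by blast
  then have "(x, d) \<in> r" using x(2) D(1) by blast
  then have "x \<in> D" using D(2)[of d x] d x(1) by blast
  then show "\<exists>x. x \<notin> A \<and> insert x A \<in> F \<and> insert x A \<subseteq> D"
    using x A(2) by (intro exI[of _ x]) blast
qed (auto simp: empty_feasible)

section \<open>The ground set and its initial segments\<close>

definition ground :: "'e set" where
  "ground = \<Union>F"

lemma ground_feasible: "ground \<in> F"
  unfolding ground_def by (rule Union_feasible) simp

lemma feasible_subset_ground: "A \<in> F \<Longrightarrow> A \<subseteq> ground"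
  by (auto simp: ground_def)

lemma ground_subset: "ground \<subseteq> E"
  using ground_feasible F_subset by blast

text \<open>Segments are taken in the largest feasible set, not in \<open>E\<close>, which may
  contain elements of no feasible set. They will form the distinguished maximal chain.\<close>

definition initial_segments :: "'e set set" where
  "initial_segments = {D. D \<subseteq> ground \<and> (\<forall>x\<in>D. \<forall>y\<in>ground. (y, x) \<in> r \<longrightarrow> y \<in> D)}"

lemma initial_segment_Int_feasible:
  assumes D: "D \<in> initial_segments" and X: "X \<in> F"
  shows "D \<inter> X \<in> F"
proof (rule initial_segment_feasible[OF X])
  fix x y assume "x \<in> D \<inter> X" "y \<in> X" "(y, x) \<in> r"
  then show "y \<in> D \<inter> X"
    using D feasible_subset_ground[OF X] unfolding initial_segments_def by blast
qed simp

lemma initial_segments_feasible: "initial_segments \<subseteq> F"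
proof
  fix D assume D: "D \<in> initial_segments"
  then have "D \<inter> ground = D" unfolding initial_segments_def by blast
  with initial_segment_Int_feasible[OF D ground_feasible] show "D \<in> F" by simp
qed

lemma initial_segments_chain:
  assumes "D \<in> initial_segments" "D' \<in> initial_segments" shows "D \<subseteq> D' \<or> D' \<subseteq> D"
proof (rule ccontr)
  assume "\<not> ?thesis"
  then obtain x y where xy: "x \<in> D - D'" "y \<in> D' - D" by blast
  then have g: "x \<in> ground" "y \<in> ground" using assms by (auto simp: initial_segments_def)
  then have "(x, y) \<in> r \<or> (y, x) \<in> r" using ground_subset by (intro r_total) auto
  then show False using xy g assms unfolding initial_segments_def by blast
qed

text \<open>This yields maximality of the chain. Let \<open>D\<close> be the largest initial segment
  inside \<open>Z\<close>. If \<open>D\<close> is not all of \<open>Z\<close>, adding the next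
  element \<open>e\<close> gives a segment not inside \<open>Z\<close>, hence one containing
  \<open>Z\<close>, so \<open>Z\<close> is squeezed between the two.\<close>

lemma comparable_initial_segments:
  assumes Z: "Z \<in> F" and cmp: "\<And>D. D \<in> initial_segments \<Longrightarrow> D \<subseteq> Z \<or> Z \<subseteq> D"
  shows "Z \<in> initial_segments"
proof -
  define D where "D = {x \<in> ground. \<forall>y\<in>ground. (y, x) \<in> r \<longrightarrow> y \<in> Z}"
  have D: "D \<in> initial_segments" unfolding initial_segments_def D_def using r_trans by blast
  have r_refl': "(x, x) \<in> r" if "x \<in> ground" for x using that ground_subset r_refl by blast
  have "D \<subseteq> Z" unfolding D_def using r_refl' by blast
  show ?thesis
  proof (cases "Z = D")
    case False
    then have "\<not> ground \<subseteq> D" using feasible_subset_ground[OF Z] \<open>D \<subseteq> Z\<close> by blast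
    from insert_min[OF _ ground_feasible this] subsetD[OF initial_segments_feasible D]
    obtain e where e: "e \<in> ground - D" "\<forall>y\<in>ground - D. (e, y) \<in> r" by blast
    have D': "insert e D \<in> initial_segments"
      unfolding initial_segments_def mem_Collect_eq
    proof (intro conjI ballI impI)
      show "insert e D \<subseteq> ground" using e D unfolding initial_segments_def by blast
      fix x y assume xy: "x \<in> insert e D" "y \<in> ground" "(y, x) \<in> r"
      show "y \<in> insert e D"
      proof (cases "x = e")
        case True
        then show ?thesis using e(2) xy r_antisym[of y e] by blast
      next
        case False
        then show ?thesis using D xy unfolding initial_segments_def by blast
      qed
    qed
    \<comment> \<open>Otherwise everything up to \<open>e\<close> in the ground set would lie in
      \<open>Z\<close>, and \<open>e\<close> would belong to \<open>D\<close> by its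
      definition.\<close>
    have "\<not> insert e D \<subseteq> Z"
    proof
      assume "insert e D \<subseteq> Z"
      then have "e \<in> D"
        using D' e(1) unfolding initial_segments_def by (auto simp: D_def)
      with e show False by blast
    qed
    then have "Z \<subseteq> insert e D" using cmp[OF D'] by blast
    then have "Z = insert e D" using \<open>D \<subseteq> Z\<close> False by blast
    with D' show ?thesis by simp
  qed (use D in simp)
qed

end

section \<open>The lattice of feasible sets\<close>

locale antimatroid_lattice = armstrong_antimatroid E F r
  for E :: "'e set" and F r +
  fixes L :: "('a, 'c) gorder_scheme" (structure) and f :: "'a \<Rightarrow> 'e set"
  assumes eq_L: "eq L = (=)"
    and bij_L: "bij_betw f (carrier L) F"
    and le_L: "\<And>x y. x \<in> carrier L \<Longrightarrow> y \<in> carrier L \<Longrightarrow> x \<sqsubseteq> y \<longleftrightarrow> f x \<subseteq> f y"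
begin

sublocale set_lattice L f F
proof
  fix A B assume "A \<in> F" "B \<in> F"
  \<comment> \<open>The union of all feasible subsets of the intersection is feasible and is the
    largest of them.\<close>
  show "\<exists>C\<in>F. C \<subseteq> A \<inter> B \<and> (\<forall>D\<in>F. D \<subseteq> A \<inter> B \<longrightarrow> D \<subseteq> C)"
    by (rule bexI[of _ "\<Union>{D \<in> F. D \<subseteq> A \<inter> B}"]) (auto intro: Union_feasible)
qed (simp_all add: eq_L bij_L le_L union_feasible)

lemma finite_lattice: "finite_lattice L"
proof -
  have "finite (carrier L)" using bij finite_F bij_betw_finite by blast
  moreover have "carrier L \<noteq> {}" using f_surj[OF empty_feasible] by blast
  ultimately show ?thesis by (simp add: finite_lattice_def lattice)
qed

text \<open>Between two nested distinct feasible sets, \<open>insert_min\<close> finds one exceeding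
  the smaller by a single element, so a cover adds exactly one.\<close>

lemma covered_by_iff:
  assumes x: "x \<in> carrier L" and y: "y \<in> carrier L"
  shows "covered_by L x y \<longleftrightarrow> (\<exists>e. e \<notin> f x \<and> f y = insert e (f x))"
proof
  assume cov: "covered_by L x y"
  then have "x \<sqsubset> y" by (simp add: covered_by_def)
  then have less: "f x \<subset> f y" by (simp only: less_iff[OF x y])
  then have "\<not> f y \<subseteq> f x" by blast
  from insert_min[OF f_in[OF x] f_in[OF y] this] obtain e
    where e: "e \<in> f y - f x" "insert e (f x) \<in> F" .
  obtain z where z: "z \<in> carrier L" "f z = insert e (f x)" using f_surj[OF e(2)] by blast
  then have "x \<sqsubset> z" unfolding less_iff[OF x z(1)] using e(1) by blast
  then have "\<not> z \<sqsubset> y" using cov z(1) by (simp add: covered_by_def)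
  then have "\<not> f z \<subset> f y" by (simp only: less_iff[OF z(1) y] not_False_eq_True)
  then have "f y = insert e (f x)" unfolding z(2) using e less by blast
  with e show "\<exists>e. e \<notin> f x \<and> f y = insert e (f x)" by blast
next
  assume "\<exists>e. e \<notin> f x \<and> f y = insert e (f x)"
  then obtain e where e: "e \<notin> f x" "f y = insert e (f x)" by blast
  have "\<not> (x \<sqsubset> z \<and> z \<sqsubset> y)" if z: "z \<in> carrier L" for z
    unfolding less_iff[OF x z] less_iff[OF z y] e(2) by blast
  moreover have "x \<sqsubset> y" unfolding less_iff[OF x y] using e by blast
  ultimately show "covered_by L x y" using x y by (simp add: covered_by_def)
qed

text \<open>The element \<open>e\<close> that \<open>x\<close> adds to the meet is not in
  \<open>y\<close>; otherwise \<open>f x\<close> would itself be a feasible subset of both and lie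
  in the meet. So the join adds just \<open>e\<close> to \<open>y\<close>.\<close>

lemma semimodular: "semimodular L"
  unfolding semimodular_def
proof (intro ballI impI)
  fix x y assume x: "x \<in> carrier L" and y: "y \<in> carrier L" and cov: "covered_by L (x \<sqinter> y) x"
  note xy = x y
  from cov obtain e where e: "e \<notin> f (x \<sqinter> y)" "f x = insert e (f (x \<sqinter> y))"
    unfolding covered_by_iff[OF meet(1)[OF xy] x] by blast
  have "e \<notin> f y"
  proof
    assume "e \<in> f y"
    moreover have "f (x \<sqinter> y) \<subseteq> f y" using meet(2)[OF xy] by simp
    ultimately have "f x \<subseteq> f y" by (simp only: e(2) insert_subset simp_thms)
    then have "f x \<subseteq> f x \<inter> f y" by simp
    from meet(3)[OF xy f_in[OF x] this] show False using e by blast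
  qed
  moreover have "f (x \<squnion> y) = insert e (f y)"
  proof -
    have "f (x \<sqinter> y) \<subseteq> f y" using meet(2)[OF xy] by simp
    then show ?thesis unfolding join(2)[OF xy] e(2) by blast
  qed
  ultimately show "covered_by L y (x \<squnion> y)" unfolding covered_by_iff[OF y join(1)[OF xy]] by blast
qed

text \<open>Every set between \<open>f x\<close> and its union with the available one-element
  extensions \<open>S\<close> is a union of feasible sets. The hypothesis on the join forces
  \<open>f y\<close> to be this union, so the interval consists of all sets between its
  ends.\<close>

lemma interval_boolean:
  assumes x: "x \<in> carrier L" and y: "y \<in> carrier L" and "x \<sqsubseteq> y"
    and lub: "is_lub (interval_order L x y) y {z \<in> \<lbrace>x..y\<rbrace>. covered_by L x z}"
  shows "boolean_lattice (interval_order L x y)"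
proof -
  define S where "S = {e. e \<notin> f x \<and> e \<in> f y \<and> insert e (f x) \<in> F}"
  have xy: "f x \<subseteq> f y" using assms le by auto
  have F_between: "A \<in> F" if A: "f x \<subseteq> A" "A \<subseteq> f x \<union> S" for A
  proof -
    have "\<Union>(insert (f x) ((\<lambda>e. insert e (f x)) ` (A \<inter> S))) \<in> F"
      using f_in[OF x] by (intro Union_feasible) (auto simp: S_def)
    moreover have "\<Union>(insert (f x) ((\<lambda>e. insert e (f x)) ` (A \<inter> S))) = A" using A by blast
    ultimately show ?thesis by simp
  qed
  have carrier: "z \<in> \<lbrace>x..y\<rbrace> \<longleftrightarrow> z \<in> carrier L \<and> f x \<subseteq> f z \<and> f z \<subseteq> f y" for z
    using x y by (auto simp: at_least_at_most_def le)
  have "f y = f x \<union> S"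
  proof
    show "f x \<union> S \<subseteq> f y" using xy by (auto simp: S_def)
    obtain u where u: "u \<in> carrier L" "f u = f x \<union> S"
      using f_surj[OF F_between[of "f x \<union> S"]] by blast
    then have "u \<in> \<lbrace>x..y\<rbrace>" using xy by (auto simp: carrier S_def)
    moreover have "z \<sqsubseteq> u" if "z \<in> \<lbrace>x..y\<rbrace>" "covered_by L x z" for z
    proof -
      have z: "z \<in> carrier L" "f z \<subseteq> f y" using that(1) by (auto simp: carrier)
      with that(2) obtain e where "e \<notin> f x" "f z = insert e (f x)" by (auto simp: covered_by_iff x)
      then have "f z \<subseteq> f u" using z f_in[OF z(1)] u by (auto simp: S_def)
      then show ?thesis using z u le by blast
    qed
    ultimately have "y \<sqsubseteq> u"
      using lub by (auto simp: least_def Upper_def interval_order_def)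
    then show "f y \<subseteq> f x \<union> S" using u y le by auto
  qed
  then have F_eq: "A \<in> F" if "f x \<subseteq> A" "A \<subseteq> f y" for A using F_between that by blast
  \<comment> \<open>The interval has joins and meets of its own, so it is treated as a set lattice
    in its own right.\<close>
  interpret I: set_lattice "interval_order L x y" f "{A. f x \<subseteq> A \<and> A \<subseteq> f y}"
  proof
    show "bij_betw f (carrier (interval_order L x y)) {A. f x \<subseteq> A \<and> A \<subseteq> f y}"
      unfolding bij_betw_def
    proof
      show "inj_on f (carrier (interval_order L x y))"
        using f_eq by (intro inj_onI) (simp add: interval_order_def carrier)
      show "f ` carrier (interval_order L x y) = {A. f x \<subseteq> A \<and> A \<subseteq> f y}"
      proof (intro equalityI subsetI)
        fix A assume A: "A \<in> {A. f x \<subseteq> A \<and> A \<subseteq> f y}"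
        then obtain z where "z \<in> carrier L" "f z = A" using F_eq[of A] f_surj by blast
        with A show "A \<in> f ` carrier (interval_order L x y)"
          by (intro image_eqI[of _ _ z]) (simp_all add: interval_order_def carrier)
      qed (auto simp: interval_order_def carrier)
    qed
    fix A B assume "A \<in> {A. f x \<subseteq> A \<and> A \<subseteq> f y}" "B \<in> {A. f x \<subseteq> A \<and> A \<subseteq> f y}"
    then show "\<exists>C\<in>{A. f x \<subseteq> A \<and> A \<subseteq> f y}. C \<subseteq> A \<inter> B \<and>
        (\<forall>D\<in>{A. f x \<subseteq> A \<and> A \<subseteq> f y}. D \<subseteq> A \<inter> B \<longrightarrow> D \<subseteq> C)"
      by (intro bexI[of _ "A \<inter> B"]) auto
  qed (auto simp: interval_order_def eq carrier le)
  show ?thesis by (rule I.boolean_latticeI[OF HOL.refl xy])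
qed

lemma join_distributive: "join_distributive_lattice L"
  unfolding join_distributive_lattice_def
  by (intro conjI ballI impI finite_lattice semimodular interval_boolean)

lemma supersolvable: "supersolvable_lattice L"
proof -
  define M where "M = {x \<in> carrier L. f x \<in> initial_segments}"
  have M: "maximal_chain L M"
    unfolding maximal_chain_def
  proof (intro conjI allI impI)
    show "chain_in L M"
      using initial_segments_chain by (auto simp: chain_in_def M_def le)
    fix C assume C: "chain_in L C \<and> M \<subseteq> C"
    have "c \<in> M" if c: "c \<in> C" for c
    proof -
      have cL: "c \<in> carrier L" using C c by (auto simp: chain_in_def)
      have "f c \<in> initial_segments"
      proof (rule comparable_initial_segments[OF f_in[OF cL]])
        fix D assume D: "D \<in> initial_segments"
        then obtain d where d: "d \<in> carrier L" "f d = D" using f_surj initial_segments_feasible by blast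
        then have "d \<in> C" using C D by (auto simp: M_def)
        then have "d \<sqsubseteq> c \<or> c \<sqsubseteq> d" using C c by (auto simp: chain_in_def)
        then show "D \<subseteq> f c \<or> f c \<subseteq> D" using d cL le by auto
      qed
      with cL show ?thesis by (simp add: M_def)
    qed
    with C show "C = M" by blast
  qed
  have "distributive_on L (sublattice_generated L (M \<union> C))" if C: "chain_in L C" for C
  proof -
    \<comment> \<open>Adjoining \<open>ground\<close> to the chain puts the initial segments
      themselves into \<open>G\<close>. The ring of sets wanted is \<open>R\<close>, all unions of
      members of \<open>G\<close>.\<close>
    define G where "G = {D \<inter> Z |D Z. D \<in> initial_segments \<and> Z \<in> insert ground (f ` C)}"
    define R where "R = {\<Union>U |U. U \<subseteq> G}"
    have CL: "C \<subseteq> carrier L" using C by (auto simp: chain_in_def)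
    then have "G \<subseteq> F"
      using initial_segment_Int_feasible ground_feasible f_in by (auto simp: G_def)
    then have RF: "R \<subseteq> F" using Union_feasible by (auto simp: R_def)
    have G_R: "A \<in> R" if "A \<in> G" for A
      unfolding R_def using that by (intro CollectI exI[of _ "{A}"]) auto
    have Int_chain: "A \<inter> B \<in> K" if "A \<subseteq> B \<or> B \<subseteq> A" "A \<in> K" "B \<in> K" for A B :: "'e set" and K
      using that by (metis Int_absorb1 Int_absorb2)
    \<comment> \<open>Initial segments form a chain, and so do the members of \<open>C\<close>
      together with \<open>ground\<close>; each factor of an intersection therefore stays in its
      family.\<close>
    have G_Int: "A \<inter> B \<in> G" if AB: "A \<in> G" "B \<in> G" for A B
    proof -
      obtain D Z D' Z' where A: "A = D \<inter> Z" "D \<in> initial_segments" "Z \<in> insert ground (f ` C)"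
        and B: "B = D' \<inter> Z'" "D' \<in> initial_segments" "Z' \<in> insert ground (f ` C)"
        using AB unfolding G_def by blast
      have "D \<inter> D' \<in> initial_segments"
        using Int_chain initial_segments_chain A(2) B(2) by blast
      moreover have "Z \<subseteq> Z' \<or> Z' \<subseteq> Z"
      proof (cases "Z = ground \<or> Z' = ground")
        case True
        have "Z \<subseteq> ground" "Z' \<subseteq> ground" using A(3) B(3) CL f_in feasible_subset_ground by auto
        with True show ?thesis by blast
      next
        case False
        then obtain c c' where "c \<in> C" "c' \<in> C" "Z = f c" "Z' = f c'" using A B by blast
        moreover from this have "c \<sqsubseteq> c' \<or> c' \<sqsubseteq> c" using C unfolding chain_in_def by blast
        ultimately show ?thesis using CL le by blast
      qed
      then have "Z \<inter> Z' \<in> insert ground (f ` C)" using A(3) B(3) by (rule Int_chain)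
      moreover have "A \<inter> B = (D \<inter> D') \<inter> (Z \<inter> Z')" using A B by blast
      ultimately show ?thesis unfolding G_def by blast
    qed
    have R_Int: "A \<inter> B \<in> R" if AB: "A \<in> R" "B \<in> R" for A B
    proof -
      obtain U V where "A = \<Union>U" "B = \<Union>V" "U \<subseteq> G" "V \<subseteq> G" using AB unfolding R_def by blast
      then have "A \<inter> B = \<Union>{X \<inter> Y |X Y. X \<in> U \<and> Y \<in> V}" "{X \<inter> Y |X Y. X \<in> U \<and> Y \<in> V} \<subseteq> G"
        using G_Int by blast+
      then show ?thesis unfolding R_def by blast
    qed
    have R_Un: "A \<union> B \<in> R" if AB: "A \<in> R" "B \<in> R" for A B
    proof -
      obtain U V where "A = \<Union>U" "B = \<Union>V" "U \<subseteq> G" "V \<subseteq> G" using AB unfolding R_def by blast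
      then have "A \<union> B = \<Union>(U \<union> V)" "U \<union> V \<subseteq> G" by blast+
      then show ?thesis unfolding R_def by blast
    qed
    have gen: "x \<in> carrier L \<and> f x \<in> R" if "x \<in> sublattice_generated L (M \<union> C)" for x
      using that
    proof induction
      case (incl x)
      then show ?case
      proof
        assume x: "x \<in> M"
        then have "f x \<inter> ground \<in> G" by (auto simp: G_def M_def)
        moreover have "f x \<inter> ground = f x" using x f_in feasible_subset_ground by (auto simp: M_def)
        ultimately show ?thesis using x G_R by (simp add: M_def)
      next
        assume x: "x \<in> C"
        have "ground \<in> initial_segments" by (auto simp: initial_segments_def)
        with x have "ground \<inter> f x \<in> G" unfolding G_def by blast
        moreover have "ground \<inter> f x = f x" using x CL f_in feasible_subset_ground by blast
        ultimately show ?thesis using x CL G_R by auto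
      qed
    next
      case (join x y)
      then show ?case using R_Un set_lattice.join[OF set_lattice_axioms, of x y] by auto
    next
      case (meet x y)
      moreover from this have "f x \<inter> f y \<in> R" "f x \<inter> f y \<in> F" using R_Int RF by auto
      ultimately show ?case
        using meet_eq_Int[of x y] set_lattice.meet(1)[OF set_lattice_axioms, of x y] by auto
    qed
    show ?thesis
    proof (rule distributive_onI[OF _ _ RF R_Int R_Un])
      show "sublattice_generated L (M \<union> C) \<subseteq> carrier L"
        "f ` sublattice_generated L (M \<union> C) \<subseteq> R"
        using gen by blast+
    qed
  qed
  then show ?thesis
    unfolding supersolvable_lattice_def by (intro conjI exI[of _ M] allI impI M finite_lattice)
qed

end

subsection \<open>Subwords of a Coxeter-type element\<close>

lemma sorted_list_of_set_Diff_singleton: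
  assumes "sorted_list_of_set A = xs @ k # ys" "finite A"
  shows "sorted_list_of_set (A - {k}) = xs @ ys"
proof -
  have "distinct (xs @ k # ys)" using assms by (metis distinct_sorted_list_of_set)
  then show ?thesis
    using assms by (simp add: sorted_list_of_set_remove remove1_append)
qed

locale coxeter_word = based_root_system +
  fixes as :: "'a list"
  assumes letters: "set as \<subseteq> \<Delta>" and distinct: "distinct as"
begin

text \<open>Position sets stand for subwords, and sorting restores the order of the letters.\<close>

definition letters_at :: "nat set \<Rightarrow> 'a list" where
  "letters_at A = map ((!) as) (sorted_list_of_set A)"

abbreviation subword :: "nat set \<Rightarrow> 'a \<Rightarrow> 'a" where
  "subword A \<equiv> reflection_word (letters_at A)"

lemma finite_positions: "A \<subseteq> {..<length as} \<Longrightarrow> finite A"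
  using finite_subset by blast

lemma inj_on_nth_positions: "inj_on ((!) as) {..<length as}"
  using distinct by (simp add: inj_on_def nth_eq_iff_index_eq)

lemma set_letters_at: "A \<subseteq> {..<length as} \<Longrightarrow> set (letters_at A) = (!) as ` A"
  using finite_positions[of A] by (simp add: letters_at_def)

lemma letters_at_base: "A \<subseteq> {..<length as} \<Longrightarrow> set (letters_at A) \<subseteq> \<Delta>"
  using letters by (force simp: set_letters_at)

lemma distinct_letters_at: "A \<subseteq> {..<length as} \<Longrightarrow> distinct (letters_at A)"
  using finite_positions[of A] inj_on_subset[OF inj_on_nth_positions, of A]
  by (simp add: letters_at_def distinct_map)

lemma subword_all: "subword {..<length as} = reflection_word as"
  by (simp add: letters_at_def lessThan_atLeast0 map_nth)

text \<open>A product of distinct simple reflections determines its set of letters, and distinct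
  positions of \<open>as\<close> carry distinct letters.\<close>

lemma subword_inj:
  assumes "A \<subseteq> {..<length as}" "B \<subseteq> {..<length as}" "subword A = subword B"
  shows "A = B"
proof -
  have "(!) as ` A = (!) as ` B"
    using distinct_word_letters[OF letters_at_base[OF assms(1)] distinct_letters_at[OF assms(1)]
        letters_at_base[OF assms(2)] distinct_letters_at[OF assms(2)] assms(3)]
    unfolding set_letters_at[OF assms(1)] set_letters_at[OF assms(2)] .
  then show ?thesis using inj_on_image_eq_iff[OF inj_on_nth_positions assms(1,2)] by blast
qed

text \<open>Going down, every Bruhat step deletes one letter. Going up, the missing positions are
  inserted one at a time, and each insertion is a Bruhat step because the letters stay
  distinct.\<close>

lemma bruhat_le_subword_iff_exists:
  assumes B: "B \<subseteq> {..<length as}"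
  shows "bruhat_le \<Phi> \<Delta> v (subword B) \<longleftrightarrow> (\<exists>A\<subseteq>B. v = subword A)"
proof
  assume "bruhat_le \<Phi> \<Delta> v (subword B)"
  then show "\<exists>A\<subseteq>B. v = subword A"
    unfolding bruhat_le_def
  proof (induction rule: converse_rtranclp_induct)
    case base
    show ?case by (intro exI[of _ B]) (simp only: order_refl simp_thms)
  next
    case (step v u)
    then obtain A where A: "A \<subseteq> B" "u = subword A" by blast
    have A_pos: "A \<subseteq> {..<length as}" using A B by blast
    have "bruhat_step \<Phi> \<Delta> v (subword A)" using step(1) unfolding A(2) .
    from bruhat_step_deletion[OF this letters_at_base[OF A_pos]] obtain xs a ys
      where *: "letters_at A = xs @ a # ys" "v = reflection_word (xs @ ys)" by blast
    \<comment> \<open>The deleted letter is traced back to its position \<open>k\<close>.\<close>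
    then obtain ks k js where "sorted_list_of_set A = ks @ k # js"
      "xs = map ((!) as) ks" "ys = map ((!) as) js"
      unfolding letters_at_def map_eq_append_conv map_eq_Cons_conv by blast
    then have "letters_at (A - {k}) = xs @ ys"
      using sorted_list_of_set_Diff_singleton[OF _ finite_positions[OF A_pos]]
      by (simp add: letters_at_def)
    then have "v = subword (A - {k})" using *(2) by (simp only:)
    then show ?case using A(1) by blast
  qed
next
  assume "\<exists>A\<subseteq>B. v = subword A"
  then obtain A where A: "A \<subseteq> B" "v = subword A" by blast
  have "bruhat_le \<Phi> \<Delta> (subword A) (subword (A \<union> C))" if "finite C" "A \<union> C \<subseteq> B" for C
    using that
  proof (induction C)
    case empty
    then show ?case by (simp add: bruhat_le_def)
  next
    case (insert k C)
    show ?case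
    proof (cases "k \<in> A \<union> C")
      case True
      then have "A \<union> insert k C = A \<union> C" by blast
      with insert show ?thesis by auto
    next
      case False
      let ?D = "A \<union> insert k C"
      have D: "?D \<subseteq> {..<length as}" using insert.prems B by blast
      have fin: "finite ?D" by (rule finite_positions[OF D])
      then have "k \<in> set (sorted_list_of_set ?D)"
        unfolding set_sorted_list_of_set[OF fin] by blast
      then obtain ks js where split: "sorted_list_of_set ?D = ks @ k # js"
        by (meson split_list)
      have "?D - {k} = A \<union> C" using False by blast
      then have "sorted_list_of_set (A \<union> C) = ks @ js"
        using sorted_list_of_set_Diff_singleton[OF split fin] by simp
      then have le: "letters_at (A \<union> C) = map ((!) as) ks @ map ((!) as) js"
        "letters_at ?D = map ((!) as) ks @ as ! k # map ((!) as) js"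
        using split by (simp_all add: letters_at_def)
      have "bruhat_step \<Phi> \<Delta> (subword (A \<union> C)) (subword ?D)"
        using letters_at_base[OF D] distinct_letters_at[OF D] unfolding le
        by (rule bruhat_step_insert)
      moreover have "bruhat_le \<Phi> \<Delta> (subword A) (subword (A \<union> C))"
        using insert.IH insert.prems by blast
      ultimately show ?thesis unfolding bruhat_le_def by (rule rtranclp.rtrancl_into_rtrancl[rotated])
    qed
  qed
  moreover have "finite B" by (rule finite_positions[OF B])
  moreover have "A \<union> B = B" using A(1) by blast
  ultimately show "bruhat_le \<Phi> \<Delta> v (subword B)" using A(2) by (metis order_refl)
qed

lemma bruhat_le_subword_iff:
  assumes "A \<subseteq> {..<length as}" "B \<subseteq> {..<length as}"
  shows "bruhat_le \<Phi> \<Delta> (subword A) (subword B) \<longleftrightarrow> A \<subseteq> B"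
  unfolding bruhat_le_subword_iff_exists[OF assms(2)]
proof
  assume "\<exists>A'\<subseteq>B. subword A = subword A'"
  then obtain A' where "A' \<subseteq> B" "subword A = subword A'" by blast
  moreover from this have "A = A'" using assms by (intro subword_inj) auto
  ultimately show "A \<subseteq> B" by simp
qed blast

text \<open>The condition \<open>no_final_letter\<close> in terms of positions: no chosen letter of
  \<open>I\<close> can be commuted to the end of the subword.\<close>

definition feasible :: "'a set \<Rightarrow> nat set set" where
  "feasible I = {A. A \<subseteq> {..<length as} \<and>
     (\<forall>i\<in>A. as ! i \<in> I \<longrightarrow> (\<exists>j\<in>A. i < j \<and> as ! i \<bullet> as ! j \<noteq> 0))}"

lemma no_final_letter_sorted:
  assumes "sorted_wrt (<) ks"
  shows "no_final_letter I (map ((!) as) ks) \<longleftrightarrow>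
    (\<forall>i\<in>set ks. as ! i \<in> I \<longrightarrow> (\<exists>j\<in>set ks. i < j \<and> as ! i \<bullet> as ! j \<noteq> 0))"
  using assms
proof (induction ks)
  case (Cons k ks)
  then have k: "\<forall>i\<in>set ks. k < i" by simp
  then have "(\<exists>j\<in>set (k # ks). i < j \<and> as ! i \<bullet> as ! j \<noteq> 0) \<longleftrightarrow>
      (\<exists>j\<in>set ks. i < j \<and> as ! i \<bullet> as ! j \<noteq> 0)" if "i \<in> set (k # ks)" for i
    using that by auto
  then show ?case using Cons k by auto
qed simp

lemma subword_min_coset_rep:
  assumes A: "A \<subseteq> {..<length as}"
  shows "subword A \<in> min_coset_reps \<Phi> \<Delta> \<Psi> \<longleftrightarrow> A \<in> feasible {a\<in>\<Delta>. - a \<in> \<Psi>}"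
proof -
  have "no_final_letter {a\<in>\<Delta>. - a \<in> \<Psi>} (letters_at A) \<longleftrightarrow> A \<in> feasible {a\<in>\<Delta>. - a \<in> \<Psi>}"
    unfolding letters_at_def no_final_letter_sorted[OF strict_sorted_list_of_set]
    using A finite_positions[OF A] by (simp add: feasible_def)
  then show ?thesis
    using distinct_word_min_coset_rep[OF letters_at_base[OF A] distinct_letters_at[OF A]] by blast
qed

text \<open>
  The condition defining \<open>feasible\<close> looks only at larger positions, so the total order of the
  antimatroid is the reversed order of positions.
\<close>

lemma feasible_antimatroid:
  "supersolvable_antimatroid {..<length as} (feasible I) {(i, j). i < length as \<and> j \<le> i}"
  unfolding supersolvable_antimatroid_def
proof (intro conjI ballI impI)
  show "linear_order_on {..<length as} {(i, j). i < length as \<and> j \<le> i}"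
    by (auto simp: order_on_defs refl_on_def trans_def antisym_def total_on_def)
  fix A B x
  assume A: "A \<in> feasible I" and B: "B \<in> feasible I" and x: "x \<in> B - A"
    and max: "\<forall>y\<in>B - A. (x, y) \<in> {(i, j). i < length as \<and> j \<le> i}"
  \<comment> \<open>The order is reversed, so \<open>x\<close> is the largest position in
    \<open>B - A\<close>. Its partner \<open>j\<close> in \<open>B\<close> lies beyond
    \<open>x\<close> and is therefore already in \<open>A\<close>.\<close>
  have "\<exists>j\<in>insert x A. x < j \<and> as ! x \<bullet> as ! j \<noteq> 0" if "as ! x \<in> I"
  proof -
    obtain j where j: "j \<in> B" "x < j" "as ! x \<bullet> as ! j \<noteq> 0"
      using B x \<open>as ! x \<in> I\<close> by (auto simp: feasible_def)
    then have "j \<in> A" using max by force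
    with j show ?thesis by blast
  qed
  then show "insert x A \<in> feasible I" using A B x by (auto simp: feasible_def)
qed (auto simp: feasible_def)

lemma bij_betw_subword:
  "bij_betw subword (feasible {a\<in>\<Delta>. - a \<in> \<Psi>})
     (carrier (bruhat_interval \<Phi> \<Delta> \<Psi> (reflection_word as)))"
  unfolding bij_betw_def
proof (intro conjI)
  let ?F = "feasible {a\<in>\<Delta>. - a \<in> \<Psi>}"
  have F: "A \<subseteq> {..<length as}" if "A \<in> ?F" for A using that by (simp add: feasible_def)
  show "inj_on subword ?F" by (intro inj_onI subword_inj F)
  have "v \<in> carrier (bruhat_interval \<Phi> \<Delta> \<Psi> (reflection_word as))" if v: "v \<in> subword ` ?F" for v
  proof -
    obtain A where A: "A \<in> ?F" "v = subword A" using v by blast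
    then have "bruhat_le \<Phi> \<Delta> v (subword {..<length as})"
      using F[OF A(1)] unfolding bruhat_le_subword_iff_exists[OF order_refl] by blast
    moreover have "v \<in> min_coset_reps \<Phi> \<Delta> \<Psi>"
      using A subword_min_coset_rep[OF F[OF A(1)]] by simp
    ultimately show ?thesis by (simp add: bruhat_interval_def subword_all)
  qed
  moreover have "v \<in> subword ` ?F" if v: "v \<in> carrier (bruhat_interval \<Phi> \<Delta> \<Psi> (reflection_word as))" for v
  proof -
    from v have "bruhat_le \<Phi> \<Delta> v (subword {..<length as})" "v \<in> min_coset_reps \<Phi> \<Delta> \<Psi>"
      by (simp_all add: bruhat_interval_def subword_all)
    moreover from this obtain A where "A \<subseteq> {..<length as}" "v = subword A"
      unfolding bruhat_le_subword_iff_exists[OF order_refl] by blast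
    ultimately show ?thesis using subword_min_coset_rep by blast
  qed
  ultimately show "subword ` ?F = carrier (bruhat_interval \<Phi> \<Delta> \<Psi> (reflection_word as))" by blast
qed

end

theorem theorem5p4:
  fixes \<Phi> \<Delta> \<Psi> :: "'a::euclidean_space set" and w :: "'a \<Rightarrow> 'a"
  assumes "root_system \<Phi>"
    and "root_base \<Phi> \<Delta>"
    and "standard_parabolic \<Phi> \<Delta> \<Psi>"
    and "w \<in> min_coset_reps \<Phi> \<Delta> \<Psi>"
    and "coxeter_type \<Delta> w"
  shows "(\<exists>(E::nat set) F r f. supersolvable_antimatroid E F r \<and>
            order_iso (bruhat_interval \<Phi> \<Delta> \<Psi> w) (inclusion_order F) f) \<and>
         join_distributive_lattice (bruhat_interval \<Phi> \<Delta> \<Psi> w) \<and>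
         supersolvable_lattice (bruhat_interval \<Phi> \<Delta> \<Psi> w)"
proof -
  interpret based_root_system \<Phi> \<Delta> by unfold_locales fact+
  obtain ss where ss: "distinct ss" "set ss \<subseteq> root_reflection ` \<Delta>" "w = word_prod ss"
    using assms(5) unfolding coxeter_type_def by blast
  obtain as where as: "set as \<subseteq> \<Delta>" "ss = map root_reflection as"
    using ss(2) unfolding simple_word_set by blast
  have "distinct as" using ss(1) as(2) by (simp add: distinct_map)
  interpret coxeter_word \<Phi> \<Delta> as by unfold_locales fact+
  let ?L = "bruhat_interval \<Phi> \<Delta> \<Psi> (reflection_word as)"
  let ?F = "feasible {a\<in>\<Delta>. - a \<in> \<Psi>}"
  let ?r = "{(i, j). i < length as \<and> j \<le> i}"
  \<comment> \<open>The encoding sends an element of the interval to its unique feasible position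
    set.\<close>
  define f where "f = inv_into ?F subword"
  note bij = bij_betw_subword[of \<Psi>]
  have f_bij: "bij_betw f (carrier ?L) ?F"
    unfolding f_def by (rule bij_betw_inv_into[OF bij])
  have f_le: "le ?L x y \<longleftrightarrow> f x \<subseteq> f y" if "x \<in> carrier ?L" "y \<in> carrier ?L" for x y
  proof -
    have "f x \<in> ?F" "f y \<in> ?F" using f_bij that by (auto simp: bij_betw_def)
    then have "bruhat_le \<Phi> \<Delta> (subword (f x)) (subword (f y)) \<longleftrightarrow> f x \<subseteq> f y"
      by (intro bruhat_le_subword_iff) (simp_all add: feasible_def)
    moreover have "subword (f x) = x" "subword (f y) = y"
      unfolding f_def using bij_betw_inv_into_right[OF bij] that by auto
    ultimately show ?thesis by (simp add: bruhat_interval_def)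
  qed
  interpret antimatroid_lattice "{..<length as}" ?F ?r ?L f
  proof
    show "eq ?L = (=)" by (simp add: bruhat_interval_def)
  qed (fact feasible_antimatroid f_bij f_le)+
  have "weak_partial_order (inclusion_order ?F)"
    by unfold_locales (auto simp: inclusion_order_def)
  moreover have "weak_partial_order ?L"
    using partial_order by (simp add: partial_order_def)
  ultimately have "order_iso ?L (inclusion_order ?F) f"
    using f_bij f_le by (simp add: order_iso_def order_emb_def inclusion_order_def)
  with feasible_antimatroid join_distributive supersolvable show ?thesis
    unfolding ss(3) as(2) by blast
qed

end
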